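(* The queries $\mathrm{PerfectMatching}$ and $\mathrm{MaxMatching}$ are in non-uniform $\mathsf{DynFO}$.
   Context: Dynamic complexity setting. An input is a relational structure over a finite domain fixed for the whole computation, with all input relations initially empty; a change inserts or deletes a single tuple of an input relation. A dynamic program maintains auxiliary relations over the domain; for every auxiliary relation $R$ and change type $\delta$ it has a first-order update formula $\varphi^R_\delta(\vec x;\vec y)$, and after the change $\delta(\vec a)$ the new $R$ is the set of $\vec b$ with $\text{current state}\models\varphi^R_\delta(\vec a;\vec b)$. The program maintains a query $q$ if a designated auxiliary relation equals $q$ of the current input after every change sequence from the empty input. Non-uniform $\mathsf{DynFO}$: the class of queries maintainable this way where the auxiliary relations may be initialized by arbitrary functions (arbitrary precomputed data depending on the domain). The input is an undirected graph $G$ on the domain, given by a single binary edge relation. $\mathrm{PerfectMatching}$ is the Boolean query "does $G$ have a perfect matching?"; $\mathrm{MaxMatching}$ returns $\{k\}$ where $k$ is the maximum size of a matching in $G$. *)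

theory Defs
  imports Main "HOL-Library.Disjoint_Sets"
begin

section \<open>Relational structures and first-order formulas\<close>

text \<open>
  A (relational) schema is the list of the arities of its relation symbols; the symbols
  themselves are the positions in that list. Domains are the sets \<open>{..<n}\<close> with \<open>n \<ge> 1\<close>,
  so that a number below \<open>n\<close> is itself a domain element and can be returned by a query.
\<close>

type_synonym schema = "nat list"
type_synonym relations = "nat \<Rightarrow> nat list set"

definition tuples :: "nat \<Rightarrow> nat \<Rightarrow> nat list set" where
  "tuples n r = {xs. length xs = r \<and> set xs \<subseteq> {..<n}}"

definition relations_over :: "nat \<Rightarrow> schema \<Rightarrow> relations \<Rightarrow> bool" where
  "relations_over n \<sigma> I \<longleftrightarrow> (\<forall>i < length \<sigma>. I i \<subseteq> tuples n (\<sigma> ! i))"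

datatype relsym = Inp nat | Aux nat

text \<open>Variables are named by natural numbers.\<close>

datatype fo =
    Eq nat nat
  | Rel relsym "nat list"
  | Neg fo
  | Conj fo fo
  | Disj fo fo
  | Exi nat fo
  | Uni nat fo

fun fv :: "fo \<Rightarrow> nat set" where
  "fv (Eq x y) = {x, y}"
| "fv (Rel R xs) = set xs"
| "fv (Neg \<phi>) = fv \<phi>"
| "fv (Conj \<phi> \<psi>) = fv \<phi> \<union> fv \<psi>"
| "fv (Disj \<phi> \<psi>) = fv \<phi> \<union> fv \<psi>"
| "fv (Exi x \<phi>) = fv \<phi> - {x}"
| "fv (Uni x \<phi>) = fv \<phi> - {x}"

fun wf_fo :: "schema \<Rightarrow> schema \<Rightarrow> fo \<Rightarrow> bool" where
  "wf_fo \<sigma> \<tau> (Eq x y) \<longleftrightarrow> True"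
| "wf_fo \<sigma> \<tau> (Rel (Inp i) xs) \<longleftrightarrow> i < length \<sigma> \<and> length xs = \<sigma> ! i"
| "wf_fo \<sigma> \<tau> (Rel (Aux j) xs) \<longleftrightarrow> j < length \<tau> \<and> length xs = \<tau> ! j"
| "wf_fo \<sigma> \<tau> (Neg \<phi>) \<longleftrightarrow> wf_fo \<sigma> \<tau> \<phi>"
| "wf_fo \<sigma> \<tau> (Conj \<phi> \<psi>) \<longleftrightarrow> wf_fo \<sigma> \<tau> \<phi> \<and> wf_fo \<sigma> \<tau> \<psi>"
| "wf_fo \<sigma> \<tau> (Disj \<phi> \<psi>) \<longleftrightarrow> wf_fo \<sigma> \<tau> \<phi> \<and> wf_fo \<sigma> \<tau> \<psi>"
| "wf_fo \<sigma> \<tau> (Exi x \<phi>) \<longleftrightarrow> wf_fo \<sigma> \<tau> \<phi>"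
| "wf_fo \<sigma> \<tau> (Uni x \<phi>) \<longleftrightarrow> wf_fo \<sigma> \<tau> \<phi>"

fun interp :: "relations \<Rightarrow> relations \<Rightarrow> relsym \<Rightarrow> nat list set" where
  "interp I A (Inp i) = I i"
| "interp I A (Aux j) = A j"

fun sat :: "nat \<Rightarrow> (relsym \<Rightarrow> nat list set) \<Rightarrow> (nat \<Rightarrow> nat) \<Rightarrow> fo \<Rightarrow> bool" where
  "sat n S v (Eq x y) \<longleftrightarrow> v x = v y"
| "sat n S v (Rel R xs) \<longleftrightarrow> map v xs \<in> S R"
| "sat n S v (Neg \<phi>) \<longleftrightarrow> \<not> sat n S v \<phi>"
| "sat n S v (Conj \<phi> \<psi>) \<longleftrightarrow> sat n S v \<phi> \<and> sat n S v \<psi>"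
| "sat n S v (Disj \<phi> \<psi>) \<longleftrightarrow> sat n S v \<phi> \<or> sat n S v \<psi>"
| "sat n S v (Exi x \<phi>) \<longleftrightarrow> (\<exists>a<n. sat n S (v(x := a)) \<phi>)"
| "sat n S v (Uni x \<phi>) \<longleftrightarrow> (\<forall>a<n. sat n S (v(x := a)) \<phi>)"

section \<open>Dynamic programs\<close>

datatype kind = Insert | Delete

text \<open>A change \<open>(\<kappa>, i, a)\<close> inserts the tuple \<open>a\<close> into, or deletes it from, input relation \<open>i\<close>.\<close>

type_synonym change = "kind \<times> nat \<times> nat list"

definition valid_change :: "nat \<Rightarrow> schema \<Rightarrow> change \<Rightarrow> bool" where
  "valid_change n \<sigma> c \<longleftrightarrow> (case c of (\<kappa>, i, a) \<Rightarrow> i < length \<sigma> \<and> a \<in> tuples n (\<sigma> ! i))"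

fun apply_change :: "change \<Rightarrow> relations \<Rightarrow> relations" where
  "apply_change (Insert, i, a) I = I(i := insert a (I i))"
| "apply_change (Delete, i, a) I = I(i := I i - {a})"

text \<open>
  In the update formula of auxiliary relation \<open>j\<close> for changes of kind \<open>\<kappa>\<close> of input relation \<open>i\<close>,
  the variables \<open>0, \<dots>, k - 1\<close> stand for the changed tuple (\<open>k\<close> the arity of input relation \<open>i\<close>)
  and \<open>k, \<dots>, k + r - 1\<close> for the tuple whose membership in the new relation is decided
  (\<open>r\<close> the arity of auxiliary relation \<open>j\<close>).
\<close>

record dyn_program =
  aux_schema :: schema
  update_fo :: "kind \<Rightarrow> nat \<Rightarrow> nat \<Rightarrow> fo"
  designated :: nat

definition wf_program :: "schema \<Rightarrow> dyn_program \<Rightarrow> bool" where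
  "wf_program \<sigma> P \<longleftrightarrow>
     designated P < length (aux_schema P) \<and>
     (\<forall>\<kappa>. \<forall>i < length \<sigma>. \<forall>j < length (aux_schema P).
        wf_fo \<sigma> (aux_schema P) (update_fo P \<kappa> i j) \<and>
        fv (update_fo P \<kappa> i j) \<subseteq> {..< \<sigma> ! i + aux_schema P ! j})"

text \<open>
  Update formulas are evaluated in the state before the change. The list \<open>a @ b\<close> is turned into
  a valuation by \<open>(!)\<close>, whose values beyond the end of the list are irrelevant by the condition
  on free variables in \<open>wf_program\<close>.
\<close>

fun step :: "nat \<Rightarrow> dyn_program \<Rightarrow> change \<Rightarrow> relations \<times> relations \<Rightarrow> relations \<times> relations" where
  "step n P (\<kappa>, i, a) (I, A) =
     (apply_change (\<kappa>, i, a) I,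
      \<lambda>j. if j < length (aux_schema P)
           then {b \<in> tuples n (aux_schema P ! j).
                   sat n (interp I A) ((!) (a @ b)) (update_fo P \<kappa> i j)}
           else {})"

definition run :: "nat \<Rightarrow> dyn_program \<Rightarrow> relations \<Rightarrow> change list \<Rightarrow> relations \<times> relations" where
  "run n P A\<^sub>0 cs = fold (step n P) cs (\<lambda>_. {}, A\<^sub>0)"

text \<open>
  A query maps the domain size and the input relations to a relation over the domain. A Boolean
  query has arity 0, with \<open>{[]}\<close> for true and \<open>{}\<close> for false.
\<close>

record query =
  query_arity :: nat
  answer :: "nat \<Rightarrow> relations \<Rightarrow> nat list set"

text \<open>
  \<open>init n\<close> is the initial auxiliary data for the domain \<open>{..<n}\<close>; it is subject to no
  computability or definability condition.
\<close>

definition maintains :: "schema \<Rightarrow> dyn_program \<Rightarrow> (nat \<Rightarrow> relations) \<Rightarrow> query \<Rightarrow> bool" where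
  "maintains \<sigma> P init q \<longleftrightarrow>
     aux_schema P ! designated P = query_arity q \<and>
     (\<forall>n \<ge> 1. \<forall>cs. (\<forall>c \<in> set cs. valid_change n \<sigma> c) \<longrightarrow>
        (case run n P (init n) cs of (I, A) \<Rightarrow> A (designated P) = answer q n I))"

definition nonuniform_DynFO :: "schema \<Rightarrow> query set" where
  "nonuniform_DynFO \<sigma> =
     {q. \<exists>P init. wf_program \<sigma> P \<and>
           (\<forall>n \<ge> 1. relations_over n (aux_schema P) (init n)) \<and>
           maintains \<sigma> P init q}"

section \<open>Matchings\<close>

text \<open>
  The undirected simple graph given by the binary input relation \<open>0\<close>: the pair \<open>(a, b)\<close>
  contributes the edge \<open>{a, b}\<close>, irrespective of its orientation, and loops are disregarded.
  Since single tuples are changed, the relation need not be symmetric at every moment.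
\<close>

definition graph_schema :: schema where
  "graph_schema = [2]"

definition edges :: "relations \<Rightarrow> nat set set" where
  "edges I = {{a, b} | a b. [a, b] \<in> I 0 \<and> a \<noteq> b}"

definition matching :: "nat set set \<Rightarrow> nat set set \<Rightarrow> bool" where
  "matching E M \<longleftrightarrow> M \<subseteq> E \<and> disjoint M"

definition perfect_matching :: "nat set \<Rightarrow> nat set set \<Rightarrow> nat set set \<Rightarrow> bool" where
  "perfect_matching V E M \<longleftrightarrow> matching E M \<and> \<Union>M = V"

definition PerfectMatching :: query where
  "PerfectMatching =
     \<lparr>query_arity = 0,
      answer = \<lambda>n I. if \<exists>M. perfect_matching {..<n} (edges I) M then {[]} else {}\<rparr>"

text \<open>The maximum size of a matching is at most \<open>n div 2\<close>, hence a domain element for \<open>n \<ge> 1\<close>.\<close>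

definition MaxMatching :: query where
  "MaxMatching =
     \<lparr>query_arity = 1,
      answer = \<lambda>n I. {[Max (card ` {M. matching (edges I) M})]}\<rparr>"

end

theory Submission
  imports Defs "HOL-Library.Z2" "HOL-Algebra.Algebraic_Closure_Type"
begin

text \<open>
  Over a field of characteristic two give every edge \<open>e\<close> of the graph a weight \<open>w e\<close>, and let
  \<open>pf w S\<close> be the sum over the perfect matchings of \<open>S\<close> of the products of the weights, that is, the
  Pfaffian of the weighted adjacency matrix (no signs are needed). If \<open>pf w S \<noteq> 0\<close> then \<open>S\<close> has a
  perfect matching. Conversely, by Schwartz--Zippel and greedy covering, \<open>n\<^sup>3\<close> assignments of weights
  from a field with at most \<open>n\<close> elements suffice for all graphs on \<open>n\<close> vertices: for each graph, one
  of them has a nonzero Pfaffian on the vertex set of some maximum matching. They are precomputed.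

  For each assignment the program stores a largest set \<open>S\<close> with \<open>pf w S \<noteq> 0\<close>, half its size, and the
  ratios \<open>pf w (S \<triangle> {i, j}) / pf w S\<close>. By the Wick relation for Pfaffians, replacing \<open>S\<close> by
  \<open>S \<triangle> {i, j}\<close> transforms the ratios by formulas with boundedly many field operations, and a set \<open>S\<close>
  that is not largest can be enlarged by some pair \<open>i, j\<close>. When an edge \<open>{a, b}\<close> changes, move \<open>a\<close> and
  \<open>b\<close> out of \<open>S\<close>; then only the ratio at \<open>a, b\<close> changes, by adding the weight of the edge (for
  deletions as well, by characteristic two). As \<open>S\<close> has lost at most four elements and the maximum has
  grown by at most two, three enlargements make \<open>S\<close> largest again.
\<close>

section \<open>Pfaffians in characteristic two\<close>

text \<open>The weighted adjacency matrix of the current graph is in general singular, so there is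
  no inverse to maintain. A largest nonsingular principal part, indexed by \<open>S\<close>, takes
  its place, and the ratios are the entries of the principal pivot transform at \<open>S\<close>.
  Every assignment carries its own such state, all are updated by the same formulas, and the answer
  is read off from the largest half size. The size of the field is pinned from both sides. A
  Pfaffian on \<open>n\<close> vertices has degree at most \<open>n / 2\<close>, so Schwartz--Zippel
  asks for more than \<open>n / 2\<close> elements; with at most \<open>n\<close> elements, each is
  coded by one domain element and arithmetic is lookup in precomputed tables. A power of two lies in
  this range for every \<open>n \<ge> 2\<close>; the one-element domain has no room for a field, but
  its answer is constant. A random assignment suits a given graph with probability at least
  \<open>1 / n\<close>. After \<open>n ^ 3\<close> greedy rounds fewer than
  \<open>2 ^ (n * n) * (1 - 1 / n) ^ (n ^ 3) \<le> 1\<close> graphs remain, hence none; and an index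
  below \<open>n ^ 3\<close> is a triple of domain elements.\<close>

class field_char2 = field +
  assumes add_self: "x + x = 0"
begin

lemma minus_eq: "- x = x"
  using add_self[of x] by (simp add: eq_neg_iff_add_eq_0 minus_equation_iff neg_eq_iff_add_eq_0)

lemma diff_eq_add: "x - y = x + y"
  by (metis diff_conv_add_uminus minus_eq)

lemma add_eq_0_iff_eq: "x + y = 0 \<longleftrightarrow> x = y"
  by (metis add_self diff_eq_add eq_iff_diff_eq_0)

end

section \<open>Pfaffians as sums over pairings, and their expansion along a row\<close>

definition pairings :: "'a set \<Rightarrow> 'a set set set" where
  "pairings S = {M. disjoint M \<and> \<Union>M = S \<and> (\<forall>e\<in>M. card e = 2)}"

definition pf :: "('a set \<Rightarrow> 'k::field_char2) \<Rightarrow> 'a set \<Rightarrow> 'k" where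
  "pf w S = (\<Sum>M\<in>pairings S. \<Prod>e\<in>M. w e)"

lemma pairings_subset: "pairings S \<subseteq> Pow (Pow S)"
  by (auto simp: pairings_def)

lemma finite_pairings: "finite S \<Longrightarrow> finite (pairings S)"
  by (meson finite_Pow_iff finite_subset pairings_subset)

lemma finite_pairing: "finite S \<Longrightarrow> M \<in> pairings S \<Longrightarrow> finite M"
  by (metis Pow_iff finite_Pow_iff finite_subset pairings_subset subsetD)

lemma card_pairing:
  assumes "finite S" "M \<in> pairings S"
  shows "card S = 2 * card M"
proof -
  have "card (\<Union>M) = sum card M"
    by (rule card_Union_disjoint) (use assms in \<open>auto simp: pairings_def disjoint_def pairwise_def disjnt_def intro: card_ge_0_finite\<close>)
  also have "\<dots> = 2 * card M"
    using assms by (simp add: pairings_def)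
  finally show ?thesis
    using assms by (simp add: pairings_def)
qed

lemma pairings_empty: "pairings {} = {{}}"
  by (force simp: pairings_def)

lemma pf_empty: "pf w {} = 1"
  by (simp add: pf_def pairings_empty)

lemma pf_nonzeroD:
  assumes "finite S" "pf w S \<noteq> 0"
  shows "\<exists>M\<in>pairings S. \<forall>e\<in>M. w e \<noteq> 0"
proof -
  obtain M where M: "M \<in> pairings S" "(\<Prod>e\<in>M. w e) \<noteq> 0"
    using assms(2) unfolding pf_def by (meson sum.neutral)
  then show ?thesis
    using finite_pairing[OF assms(1) M(1)] by (intro bexI[of _ M]) auto
qed

lemma pairings_insert:
  assumes "i \<notin> Y"
  shows "pairings (insert i Y) = (\<Union>k\<in>Y. insert {i, k} ` pairings (Y - {k}))"
proof (intro equalityI subsetI)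
  fix M assume M: "M \<in> pairings (insert i Y)"
  then obtain e where e: "e \<in> M" "i \<in> e"
    by (auto simp: pairings_def)
  with M have "card e = 2" by (simp add: pairings_def)
  with e obtain k where k: "e = {i, k}" "k \<noteq> i"
    by (auto simp: card_2_iff insert_commute)
  have "k \<in> Y" using M e k by (auto simp: pairings_def)
  moreover have "M - {e} \<in> pairings (Y - {k})"
  proof -
    have eq: "x = e" if "x \<in> M" "i \<in> x \<or> k \<in> x" for x
    proof -
      have "x \<inter> e \<noteq> {}" using that k by blast
      then show ?thesis using M e that by (auto simp only: pairings_def disjoint_def)
    qed
    have un: "\<Union>M = insert i Y" using M by (simp add: pairings_def)
    have "\<Union>(M - {e}) = Y - {k}"
    proof (intro equalityI subsetI)
      fix y assume "y \<in> \<Union>(M - {e})"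
      then obtain x where x: "x \<in> M" "x \<noteq> e" "y \<in> x" by auto
      then have "y \<noteq> i" "y \<noteq> k" using eq by auto
      then show "y \<in> Y - {k}" using x un by auto
    next
      fix y assume y: "y \<in> Y - {k}"
      then obtain x where x: "x \<in> M" "y \<in> x" using un by auto
      then have "x \<noteq> e" using y k assms by auto
      then show "y \<in> \<Union>(M - {e})" using x by auto
    qed
    then show ?thesis
      using M by (auto simp: pairings_def disjoint_def)
  qed
  moreover have "M = insert {i, k} (M - {e})" using e k by auto
  ultimately show "M \<in> (\<Union>k\<in>Y. insert {i, k} ` pairings (Y - {k}))" by blast
next
  fix M assume "M \<in> (\<Union>k\<in>Y. insert {i, k} ` pairings (Y - {k}))"
  then obtain k N where k: "k \<in> Y" and N: "N \<in> pairings (Y - {k})" "M = insert {i, k} N"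
    by auto
  have "e \<inter> {i, k} = {}" if "e \<in> N" for e
    using that N assms by (auto simp: pairings_def)
  then have "disjoint M"
    using N by (auto simp: pairings_def disjoint_def)
  moreover have "card {i, k} = 2" using k assms by (auto simp: card_2_iff)
  ultimately show "M \<in> pairings (insert i Y)"
    using N k by (auto simp: pairings_def)
qed

text \<open>Expansion along the row of \<open>i\<close>: the pairings are sorted by the partner
  \<open>k\<close> of \<open>i\<close>. Two partners never give the same pairing, since only one
  edge of a pairing contains \<open>i\<close>.\<close>

lemma pf_insert:
  assumes "finite Y" "i \<notin> Y"
  shows "pf w (insert i Y) = (\<Sum>k\<in>Y. w {i, k} * pf w (Y - {k}))"
proof -
  have fresh: "{i, k} \<notin> M" if "M \<in> pairings (Y - {l})" for k l M
    using that assms by (auto simp: pairings_def)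
  have inj: "inj_on (insert {i, k}) (pairings (Y - {k}))" for k
    using fresh[of _ k k] by (intro inj_onI) (simp add: insert_ident)
  have "pf w (insert i Y) = (\<Sum>k\<in>Y. \<Sum>M\<in>insert {i, k} ` pairings (Y - {k}). \<Prod>e\<in>M. w e)"
    unfolding pf_def pairings_insert[OF assms(2)]
  proof (rule sum.UNION_disjoint)
    show "\<forall>k\<in>Y. \<forall>l\<in>Y. k \<noteq> l \<longrightarrow>
      insert {i, k} ` pairings (Y - {k}) \<inter> insert {i, l} ` pairings (Y - {l}) = {}"
    proof (intro ballI impI)
      fix k l assume kl: "k \<in> Y" "l \<in> Y" "k \<noteq> l"
      then have "{i, k} \<noteq> {i, l}" using assms by (auto simp: doubleton_eq_iff)
      have False if "M \<in> pairings (Y - {k})" "N \<in> pairings (Y - {l})" "insert {i, k} M = insert {i, l} N" for M N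
        using that(3) fresh[OF that(2), of k] \<open>{i, k} \<noteq> {i, l}\<close> by auto
      then show "insert {i, k} ` pairings (Y - {k}) \<inter> insert {i, l} ` pairings (Y - {l}) = {}"
        by (auto simp only: disjoint_iff image_iff)
    qed
  qed (use assms in \<open>auto intro!: finite_imageI finite_pairings\<close>)
  also have "\<dots> = (\<Sum>k\<in>Y. w {i, k} * pf w (Y - {k}))"
  proof (rule sum.cong)
    fix k assume "k \<in> Y"
    have "(\<Sum>M\<in>insert {i, k} ` pairings (Y - {k}). \<Prod>e\<in>M. w e)
        = (\<Sum>M\<in>pairings (Y - {k}). \<Prod>e\<in>insert {i, k} M. w e)"
      using inj by (simp add: sum.reindex)
    also have "\<dots> = (\<Sum>M\<in>pairings (Y - {k}). w {i, k} * (\<Prod>e\<in>M. w e))"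
      using fresh finite_pairing[of "Y - {k}"] assms(1) by (intro sum.cong) (simp_all add: prod.insert)
    finally show "(\<Sum>M\<in>insert {i, k} ` pairings (Y - {k}). \<Prod>e\<in>M. w e) = w {i, k} * pf w (Y - {k})"
      by (simp add: pf_def sum_distrib_left)
  qed simp
  finally show ?thesis .
qed

lemma pf_cong:
  assumes "\<And>e. e \<subseteq> S \<Longrightarrow> card e = 2 \<Longrightarrow> w e = w' e"
  shows "pf w S = pf w' S"
  unfolding pf_def using assms by (intro sum.cong prod.cong) (auto simp: pairings_def)

text \<open>The terms at \<open>(k, l)\<close> and \<open>(l, k)\<close> cancel in characteristic
  two; the diagonal, where this fails, is left out.\<close>

lemma sum_symmetric_off_diagonal:
  fixes g :: "'a \<Rightarrow> 'a \<Rightarrow> 'k::field_char2"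
  assumes "finite A" "\<And>k l. g k l = g l k"
  shows "(\<Sum>k\<in>A. \<Sum>l\<in>A - {k}. g k l) = 0"
  using assms(1)
proof (induction A)
  case (insert a A)
  have "(\<Sum>k\<in>A. \<Sum>l\<in>insert a A - {k}. g k l) = (\<Sum>k\<in>A. g a k + (\<Sum>l\<in>A - {k}. g k l))"
  proof (rule sum.cong)
    fix k assume "k \<in> A"
    then have "insert a A - {k} = insert a (A - {k})" using insert by auto
    then show "(\<Sum>l\<in>insert a A - {k}. g k l) = g a k + (\<Sum>l\<in>A - {k}. g k l)"
      using insert assms(2) by simp
  qed simp
  then show ?case
    using insert by (simp add: sum.distrib add_self flip: add.assoc)
qed simp

text \<open>For \<open>j\<close> in \<open>Y\<close> the left side expands a Pfaffian in which the
  row of \<open>j\<close> occurs twice: expanding each factor along \<open>j\<close> once more gives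
  a double sum symmetric in the two partners, which vanishes. The conditional puts zeros on the
  diagonal of the matrix, because \<open>w {j, j}\<close> is the weight of a singleton and may be
  anything.\<close>

lemma pf_expand:
  assumes "finite Y"
  shows "(\<Sum>k\<in>Y. (if j = k then 0 else w {j, k}) * pf w (Y - {k})) = (if j \<in> Y then 0 else pf w (insert j Y))"
proof (cases "j \<in> Y")
  case True
  define Z where "Z = Y - {j}"
  have Y: "Y = insert j Z" "j \<notin> Z" "finite Z" using True assms by (auto simp: Z_def)
  have "(\<Sum>k\<in>Y. (if j = k then 0 else w {j, k}) * pf w (Y - {k})) = (\<Sum>k\<in>Z. w {j, k} * pf w (insert j (Z - {k})))"
  proof -
    have "insert j Z - {k} = insert j (Z - {k})" if "k \<in> Z" for k using that Y(2) by auto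
    then show ?thesis
      unfolding Y(1) sum.insert[OF Y(3,2)] using Y(2) by (simp, intro sum.cong) auto
  qed
  also have "\<dots> = (\<Sum>k\<in>Z. \<Sum>l\<in>Z - {k}. w {j, k} * (w {j, l} * pf w (Z - {k} - {l})))"
    using Y by (simp add: pf_insert sum_distrib_left)
  also have "\<dots> = 0"
  proof (rule sum_symmetric_off_diagonal[OF Y(3)])
    fix k l
    have "Z - {k} - {l} = Z - {l} - {k}" by blast
    then show "w {j, k} * (w {j, l} * pf w (Z - {k} - {l})) = w {j, l} * (w {j, k} * pf w (Z - {l} - {k}))"
      by (simp only: mult.left_commute)
  qed
  finally show ?thesis using True by simp
next
  case False
  then have "(\<Sum>k\<in>Y. (if j = k then 0 else w {j, k}) * pf w (Y - {k})) = (\<Sum>k\<in>Y. w {j, k} * pf w (Y - {k}))"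
    by (intro sum.cong) auto
  then show ?thesis using False assms by (simp add: pf_insert)
qed

section \<open>The Wick relation and the exchange properties of sets with nonzero Pfaffian\<close>

definition flip :: "'a \<Rightarrow> 'a set \<Rightarrow> 'a set" where
  "flip i S = (if i \<in> S then S - {i} else insert i S)"

lemma flip_flip [simp]: "flip i (flip i S) = S"
  by (auto simp: flip_def)

lemma flip_left_commute: "flip i (flip j S) = flip j (flip i S)"
  by (auto simp: flip_def)

lemma in_flip_iff: "x \<in> flip i S \<longleftrightarrow> (x = i) \<noteq> (x \<in> S)"
  by (auto simp: flip_def)

lemma finite_flip [simp]: "finite (flip i S) = finite S"
  by (auto simp: flip_def)

text \<open>The double sum of \<open>?a j k * pf w (S - {j}) * pf w (T - {k})\<close> over
  \<open>j\<close> in \<open>S\<close> and \<open>k\<close> in \<open>T\<close> is evaluated in both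
  orders. By \<open>pf_expand\<close> the inner sum over \<open>k\<close> is
  \<open>pf w (insert j T)\<close>, or zero if \<open>j\<close> is already in \<open>T\<close>, so
  one order leaves the terms for \<open>S - T\<close> and the other those for \<open>T - S\<close>.
  These two halves of the claimed sum are therefore equal and cancel.\<close>

lemma pf_wick:
  assumes "finite S" "finite T"
  shows "(\<Sum>j\<in>sym_diff S T. pf w (flip j S) * pf w (flip j T)) = 0"
proof -
  let ?a = "\<lambda>j k. if j = k then 0 else w {j, k}"
  have sym: "?a j k = ?a k j" for j k by (simp add: insert_commute)
  have half: "(\<Sum>j\<in>A. \<Sum>k\<in>B. ?a j k * pf w (A - {j}) * pf w (B - {k}))
      = (\<Sum>j\<in>A - B. pf w (flip j A) * pf w (flip j B))" if "finite A" "finite B" for A B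
  proof -
    have "(\<Sum>j\<in>A. \<Sum>k\<in>B. ?a j k * pf w (A - {j}) * pf w (B - {k}))
      = (\<Sum>j\<in>A. pf w (A - {j}) * (\<Sum>k\<in>B. ?a j k * pf w (B - {k})))"
      by (simp add: sum_distrib_left mult_ac)
    also have "\<dots> = (\<Sum>j\<in>A. if j \<in> B then 0 else pf w (A - {j}) * pf w (insert j B))"
      unfolding pf_expand[OF that(2)] by (intro sum.cong) auto
    also have "\<dots> = (\<Sum>j\<in>A - B. pf w (flip j A) * pf w (flip j B))"
      using that by (intro sum.mono_neutral_cong_right) (auto simp: flip_def)
    finally show ?thesis .
  qed
  have "(\<Sum>j\<in>S - T. pf w (flip j S) * pf w (flip j T)) = (\<Sum>j\<in>T - S. pf w (flip j T) * pf w (flip j S))"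
    unfolding half[OF assms, symmetric] half[OF assms(2,1), symmetric]
    using sym by (subst sum.swap) (simp add: mult_ac)
  moreover have "(S - T) \<inter> (T - S) = {}" by auto
  ultimately show ?thesis
    using assms by (simp add: sum.union_disjoint add_self mult.commute)
qed

text \<open>The case of \<open>pf_wick\<close> in which the symmetric difference has four elements;
  the term at \<open>i\<close> becomes the left side. It is the Pfaffian analogue of the three-term
  Pluecker relation.\<close>

lemma pf_three_term:
  assumes "finite S" "distinct [i, j, k, l]"
  shows "pf w S * pf w (flip i (flip j (flip k (flip l S))))
       = pf w (flip i (flip j S)) * pf w (flip k (flip l S))
       + pf w (flip i (flip k S)) * pf w (flip j (flip l S))
       + pf w (flip i (flip l S)) * pf w (flip j (flip k S))"
proof -
  let ?T = "flip i S" and ?U = "flip j (flip k (flip l S))"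
  have "sym_diff ?T ?U = {i, j, k, l}"
    using assms(2) by (auto simp: in_flip_iff)
  then have "(\<Sum>m\<in>{i, j, k, l}. pf w (flip m ?T) * pf w (flip m ?U)) = 0"
    using pf_wick[of ?T ?U w] assms(1) by simp
  then have "pf w S * pf w (flip i (flip j (flip k (flip l S)))) = 
      pf w (flip j (flip i S)) * pf w (flip k (flip l S))
       + (pf w (flip k (flip i S)) * pf w (flip j (flip l S))
       + pf w (flip l (flip i S)) * pf w (flip j (flip k S)))"
    using assms(2) by (simp add: add_eq_0_iff_eq flip_left_commute[of k j] flip_left_commute[of l j] flip_left_commute[of l k])
  then show ?thesis
    by (simp add: flip_left_commute[of j i] flip_left_commute[of k i] flip_left_commute[of l i] add.assoc)
qed

text \<open>The sets with nonzero Pfaffian (the feasible sets) form an even delta-matroid, and this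
  is its exchange property, with both sets exchanged at once. In \<open>pf_wick\<close> for
  \<open>flip i S\<close> and \<open>flip i U\<close> the term at \<open>i\<close> is
  \<open>pf w S * pf w U\<close>, hence nonzero, so another term must be nonzero as well.\<close>

lemma pf_exchange:
  assumes "finite S" "finite U" "pf w S \<noteq> 0" "pf w U \<noteq> 0" "i \<in> sym_diff S U"
  obtains j where "j \<in> sym_diff S U" "j \<noteq> i"
    "pf w (flip i (flip j S)) \<noteq> 0" "pf w (flip i (flip j U)) \<noteq> 0"
proof -
  let ?f = "\<lambda>j. pf w (flip j (flip i S)) * pf w (flip j (flip i U))"
  have "sym_diff (flip i S) (flip i U) = sym_diff S U"
    by (auto simp: in_flip_iff)
  then have "0 = (\<Sum>j\<in>sym_diff S U. ?f j)"
    using pf_wick[of "flip i S" "flip i U" w] assms by simp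
  also have "\<dots> = ?f i + (\<Sum>j\<in>sym_diff S U - {i}. ?f j)"
    using assms by (intro sum.remove) auto
  finally have "(\<Sum>j\<in>sym_diff S U - {i}. ?f j) \<noteq> 0"
    using assms by auto
  then obtain j where "j \<in> sym_diff S U - {i}" "?f j \<noteq> 0"
    by (meson sum.neutral)
  then show ?thesis
    using that[of j] flip_left_commute[of j i] by (metis Diff_iff insertI1 mult_eq_0_iff)
qed

text \<open>Exchange at some \<open>i\<close> in \<open>U - S\<close>. If the partner
  \<open>j\<close> lies in \<open>U\<close>, the pair is found. Otherwise \<open>j\<close> is in
  \<open>S - U\<close>, and the same exchange applied to \<open>U\<close> gives a feasible set of
  equal size that is closer to \<open>S\<close>; hence the induction on
  \<open>card (S - U)\<close>.\<close>

lemma pf_augment: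
  assumes "finite S" "pf w S \<noteq> 0" "finite U" "pf w U \<noteq> 0" "card S < card U"
  obtains i j where "i \<in> U - S" "j \<in> U - S" "i \<noteq> j" "pf w (flip i (flip j S)) \<noteq> 0"
proof -
  have "\<exists>i\<in>U - S. \<exists>j\<in>U - S. i \<noteq> j \<and> pf w (flip i (flip j S)) \<noteq> 0"
    using assms(3-)
  proof (induction "card (S - U)" arbitrary: U rule: less_induct)
    case less
    have "\<not> U \<subseteq> S" using less assms(1) card_mono linorder_not_less by blast
    then obtain i where i: "i \<in> U - S" by auto
    then have "i \<in> sym_diff S U" by auto
    then obtain j where j: "j \<in> sym_diff S U" "j \<noteq> i"
      "pf w (flip i (flip j S)) \<noteq> 0" "pf w (flip i (flip j U)) \<noteq> 0"
      using pf_exchange[OF assms(1) less.prems(1) assms(2) less.prems(2)] by metis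
    show ?case
    proof (cases "j \<in> U")
      case True
      then have "j \<in> U - S" using j(1) by auto
      then show ?thesis using i j(3) j(2)[symmetric] by (intro bexI[of _ i] bexI[of _ j] conjI)
    next
      case False
      let ?U = "flip i (flip j U)"
      have U: "?U = insert j (U - {i})" using False i j by (auto simp: flip_def)
      have "card ?U = card U" using U False i less.prems
        by (simp add: card.insert_remove card_Suc_Diff1)
      moreover have "S - ?U \<subset> S - U" using U False i j by auto
      then have "card (S - ?U) < card (S - U)" using assms(1) by (intro psubset_card_mono) auto
      ultimately obtain i' j' where "i' \<in> ?U - S" "j' \<in> ?U - S" "i' \<noteq> j'" "pf w (flip i' (flip j' S)) \<noteq> 0"
        using less.hyps[of ?U] less.prems j by auto
      moreover have "?U - S \<subseteq> U - S" using U False j by auto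
      ultimately show ?thesis by blast
    qed
  qed
  then show ?thesis by (elim bexE conjE) (rule that)
qed

text \<open>The Pfaffian is affine in a single weight, with slope the Pfaffian of the remaining
  vertices: in the expansion along \<open>a\<close> only the term with partner \<open>b\<close> sees
  the change.\<close>

lemma pf_upd:
  assumes "finite T" "a \<noteq> b"
  shows "pf (w({a, b} := w {a, b} + d)) T
       = pf w T + (if a \<in> T \<and> b \<in> T then d * pf w (T - {a, b}) else 0)"
proof (cases "a \<in> T")
  case False
  then have "pf (w({a, b} := w {a, b} + d)) T = pf w T"
    by (intro pf_cong) auto
  then show ?thesis using False by simp
next
  case True
  let ?w = "w({a, b} := w {a, b} + d)"
  define Y where "Y = T - {a}"
  have T: "T = insert a Y" "a \<notin> Y" "finite Y" using True assms by (auto simp: Y_def)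
  have eq: "pf ?w (Y - {k}) = pf w (Y - {k})" for k
    using T by (intro pf_cong) auto
  have "pf ?w T = (\<Sum>k\<in>Y. ?w {a, k} * pf w (Y - {k}))"
    using T by (simp add: pf_insert eq)
  also have "\<dots> = (\<Sum>k\<in>Y. w {a, k} * pf w (Y - {k}) + (if k = b then d * pf w (Y - {b}) else 0))"
    using assms by (intro sum.cong) (auto simp: doubleton_eq_iff distrib_right)
  also have "\<dots> = pf w T + (if b \<in> Y then d * pf w (Y - {b}) else 0)"
    using T by (simp add: sum.distrib pf_insert)
  moreover have "Y - {b} = T - {a, b}" using T by auto
  ultimately show ?thesis using T assms by auto
qed

section \<open>Pivoting\<close>

record 'k local_state =
  basis :: "nat set"
  ratio :: "nat \<Rightarrow> nat \<Rightarrow> 'k"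
  half :: nat

text \<open>The principal pivot transform at the pair \<open>i\<close>, \<open>j\<close>, with zero
  diagonal. When \<open>k\<close> or \<open>l\<close> belongs to the pair, flips cancel and a
  quotient of two ratios remains; if all flips cancel, the numerator is \<open>1\<close>, where a
  lookup on the diagonal of \<open>M\<close> would give zero. The last case is the three-term
  relation.\<close>

definition pivot_ratio :: "('a \<Rightarrow> 'a \<Rightarrow> 'k::field_char2) \<Rightarrow> 'a \<Rightarrow> 'a \<Rightarrow> 'a \<Rightarrow> 'a \<Rightarrow> 'k" where
  "pivot_ratio M i j k l =
    (if k = l then 0
     else if k = i then (if l = j then 1 else M j l) / M i j
     else if k = j then (if l = i then 1 else M i l) / M i j
     else if l = i then M j k / M i j
     else if l = j then M i k / M i j
     else M k l + (M i k * M j l + M i l * M j k) / M i j)"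

text \<open>The cap at \<open>n - 1\<close> keeps the value a domain element on every state that can
  be encoded; on valid states the true value is at most \<open>n div 2\<close> and passes
  unchanged.\<close>

definition pivot_half :: "nat \<Rightarrow> nat set \<Rightarrow> nat \<Rightarrow> nat \<Rightarrow> nat \<Rightarrow> nat" where
  "pivot_half n S i j h =
    (if i \<in> S \<and> j \<in> S then h - 1 else if i \<in> S \<or> j \<in> S then h else min (h + 1) (n - 1))"

text \<open>On a valid state the ratio at \<open>i = j\<close> is zero, so equal indices leave the
  state alone. The operations below use this to express that there is nothing to do.\<close>

definition pivot :: "nat \<Rightarrow> nat \<Rightarrow> nat \<Rightarrow> 'k::field_char2 local_state \<Rightarrow> 'k local_state" where
  "pivot n i j st =
    (if ratio st i j = 0 then st
     else \<lparr>basis = flip i (flip j (basis st)), ratio = pivot_ratio (ratio st) i j,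
           half = pivot_half n (basis st) i j (half st)\<rparr>)"

text \<open>A formula cannot make an arbitrary choice, but it can name the least candidate by means
  of a stored linear order.\<close>

definition pick :: "nat \<Rightarrow> (nat \<Rightarrow> bool) \<Rightarrow> nat \<Rightarrow> nat" where
  "pick n Q d = (if \<exists>i<n. Q i then LEAST i. i < n \<and> Q i else d)"

definition remove :: "nat \<Rightarrow> nat \<Rightarrow> 'k::field_char2 local_state \<Rightarrow> 'k local_state" where
  "remove n a st =
    pivot n a (pick n (\<lambda>j. a \<in> basis st \<and> j \<in> basis st \<and> ratio st a j \<noteq> 0) a) st"

definition add_edge :: "nat \<Rightarrow> nat \<Rightarrow> 'k \<Rightarrow> 'k::field_char2 local_state \<Rightarrow> 'k local_state" where
  "add_edge a b d st =
    st\<lparr>ratio := \<lambda>k l. ratio st k l + (if k = a \<and> l = b \<or> k = b \<and> l = a then d else 0)\<rparr>"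

text \<open>The default \<open>0\<close> is a placeholder: if there is no free pair,
  \<open>free_column\<close> finds no partner for it and returns the row itself, so that the pivot
  does nothing.\<close>

definition free_row :: "nat \<Rightarrow> 'k::field_char2 local_state \<Rightarrow> nat" where
  "free_row n st = pick n (\<lambda>i. i \<notin> basis st \<and> (\<exists>j<n. j \<notin> basis st \<and> ratio st i j \<noteq> 0)) 0"

definition free_column :: "nat \<Rightarrow> 'k::field_char2 local_state \<Rightarrow> nat \<Rightarrow> nat" where
  "free_column n st i = pick n (\<lambda>j. i \<notin> basis st \<and> j \<notin> basis st \<and> ratio st i j \<noteq> 0) i"

definition augment :: "nat \<Rightarrow> 'k::field_char2 local_state \<Rightarrow> 'k local_state" where
  "augment n st = pivot n (free_row n st) (free_column n st (free_row n st)) st"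

definition update :: "nat \<Rightarrow> nat \<Rightarrow> nat \<Rightarrow> 'k \<Rightarrow> 'k::field_char2 local_state \<Rightarrow> 'k local_state" where
  "update n a b d st =
    augment n (augment n (augment n (add_edge a b d (remove n b (remove n a st)))))"

definition valid :: "nat \<Rightarrow> (nat set \<Rightarrow> 'k::field_char2) \<Rightarrow> 'k local_state \<Rightarrow> bool" where
  "valid n w st \<longleftrightarrow>
    basis st \<subseteq> {..<n} \<and> pf w (basis st) \<noteq> 0 \<and> half st = card (basis st) div 2 \<and>
    (\<forall>i j. ratio st i j = (if i = j then 0 else pf w (flip i (flip j (basis st))) / pf w (basis st)))"

definition optimal :: "nat \<Rightarrow> (nat set \<Rightarrow> 'k::field_char2) \<Rightarrow> 'k local_state \<Rightarrow> bool" where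
  "optimal n w st \<longleftrightarrow> valid n w st \<and> (\<forall>U\<subseteq>{..<n}. pf w U \<noteq> 0 \<longrightarrow> card U \<le> card (basis st))"

lemma pick_cases:
  "pick n Q d < n \<and> Q (pick n Q d) \<or> (\<forall>i<n. \<not> Q i) \<and> pick n Q d = d"
proof (cases "\<exists>i<n. Q i")
  case True
  then show ?thesis using LeastI_ex[of "\<lambda>i. i < n \<and> Q i"] by (simp add: pick_def)
qed (auto simp: pick_def)

lemma pick_default: "\<not> (\<exists>i<n. Q i) \<Longrightarrow> pick n Q d = d"
  by (auto simp: pick_def)

lemma pickI: "\<exists>i<n. Q i \<Longrightarrow> pick n Q d < n \<and> Q (pick n Q d)"
  using pick_cases[of n Q d] by auto

lemma pick_lt: "d < n \<Longrightarrow> pick n Q d < n"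
  using pick_cases[of n Q d] by auto

lemma valid_finite: "valid n w st \<Longrightarrow> finite (basis st)"
  by (auto simp: valid_def intro: finite_subset)

lemma pivot_ratio_correct:
  assumes "finite S" "pf w S \<noteq> 0" "i \<noteq> j" "pf w (flip i (flip j S)) \<noteq> 0"
    and M: "\<And>k l. M k l = (if k = l then 0 else pf w (flip k (flip l S)) / pf w S)"
  shows "pivot_ratio M i j k l
    = (if k = l then 0 else pf w (flip k (flip l (flip i (flip j S)))) / pf w (flip i (flip j S)))"
proof (cases "distinct [i, j, k, l]")
  case True
  have "pivot_ratio M i j k l = M k l + (M i k * M j l + M i l * M j k) / M i j"
    using True by (auto simp: pivot_ratio_def)
  also have "\<dots> = (pf w (flip i (flip j S)) * pf w (flip k (flip l S))
       + pf w (flip i (flip k S)) * pf w (flip j (flip l S))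
       + pf w (flip i (flip l S)) * pf w (flip j (flip k S))) / (pf w S * pf w (flip i (flip j S)))"
    using True assms(2,4) by (simp add: M field_simps)
  also have "\<dots> = pf w (flip i (flip j (flip k (flip l S)))) / pf w (flip i (flip j S))"
    unfolding pf_three_term[OF assms(1) True, symmetric] using assms(2) by simp
  also have "flip i (flip j (flip k (flip l S))) = flip k (flip l (flip i (flip j S)))"
    by (simp add: flip_left_commute)
  finally show ?thesis using True by simp
next
  case False
  then consider "k = l" | "k = i" "k \<noteq> l" | "k = j" "k \<noteq> l" | "l = i" "k \<noteq> l" "k \<noteq> i" "k \<noteq> j"
    | "l = j" "k \<noteq> l" "k \<noteq> i" "k \<noteq> j"
    using assms(3) by auto
  then show ?thesis
    by cases (use assms(2-4) in \<open>auto simp: pivot_ratio_def M flip_left_commute\<close>)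
qed

lemma card_flip_flip:
  assumes "finite S" "i \<noteq> j"
  shows "i \<in> S \<Longrightarrow> j \<in> S \<Longrightarrow> card S = card (flip i (flip j S)) + 2"
    and "i \<notin> S \<Longrightarrow> j \<notin> S \<Longrightarrow> card (flip i (flip j S)) = card S + 2"
    and "(i \<in> S) \<noteq> (j \<in> S) \<Longrightarrow> card (flip i (flip j S)) = card S"
proof -
  have flip: "card (flip k T) = (if k \<in> T then card T - 1 else card T + 1)" if "finite T" for k T
    using that by (auto simp: flip_def)
  have pos: "Suc (card T - Suc 0) = card T" if "k \<in> T" "finite T" for k T
    using that by (metis One_nat_def Suc_pred card_gt_0_iff empty_iff)
  have "i \<in> flip j S \<longleftrightarrow> i \<in> S" using assms by (auto simp: in_flip_iff)
  then have *: "card (flip i (flip j S)) = (if i \<in> S then card (flip j S) - 1 else card (flip j S) + 1)"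
    "i \<in> S \<Longrightarrow> Suc (card (flip j S) - Suc 0) = card (flip j S)"
    using assms pos[of i "flip j S"] by (simp_all add: flip)
  show "i \<in> S \<Longrightarrow> j \<in> S \<Longrightarrow> card S = card (flip i (flip j S)) + 2"
    and "i \<notin> S \<Longrightarrow> j \<notin> S \<Longrightarrow> card (flip i (flip j S)) = card S + 2"
    and "(i \<in> S) \<noteq> (j \<in> S) \<Longrightarrow> card (flip i (flip j S)) = card S"
    using *(2) pos[of j S] assms by (auto simp: *(1) flip[of S j])
qed

lemma pivot_valid:
  assumes v: "valid n w st" and "i < n" "j < n"
  shows "valid n w (pivot n i j st)"
proof (cases "ratio st i j = 0")
  case True
  then show ?thesis using v by (simp add: pivot_def)
next
  case False
  let ?S = "basis st" and ?S' = "flip i (flip j (basis st))"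
  have fin: "finite ?S" using v by (rule valid_finite)
  have M: "ratio st k l = (if k = l then 0 else pf w (flip k (flip l ?S)) / pf w ?S)" for k l
    using v by (auto simp: valid_def)
  have ij: "i \<noteq> j" "pf w ?S' \<noteq> 0" and nz: "pf w ?S \<noteq> 0"
    using False v M[of i j] by (auto simp: valid_def split: if_splits)
  have sub: "?S' \<subseteq> {..<n}" using v assms by (auto simp: valid_def flip_def)
  then have le: "card ?S' \<le> n" by (metis card_lessThan card_mono finite_lessThan)
  \<comment> \<open>The bound \<open>le\<close> on the new set shows that the cap in
    \<open>pivot_half\<close> does not cut the value.\<close>
  have "pivot_half n ?S i j (half st) = card ?S' div 2"
    using v le assms ij(1) card_flip_flip[OF fin ij(1)]
    by (auto simp: valid_def pivot_half_def)
  then show ?thesis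
    using False sub ij nz pivot_ratio_correct[OF fin nz ij M] by (simp add: valid_def pivot_def)
qed

lemma remove_valid: "valid n w st \<Longrightarrow> a < n \<Longrightarrow> valid n w (remove n a st)"
  unfolding remove_def by (intro pivot_valid pick_lt)

text \<open>A nonzero Pfaffian has a nonzero term in its expansion along \<open>a\<close>, so some
  \<open>k\<close> leaves the basis without \<open>a\<close> and \<open>k\<close> feasible. Hence
  \<open>a\<close> can always be expelled at the cost of one further element.\<close>

lemma remove_basis:
  assumes v: "valid n w st" and "a < n"
  shows "basis (remove n a st) \<subseteq> basis st - {a}" "card (basis st) \<le> card (basis (remove n a st)) + 2"
proof -
  let ?S = "basis st"
  let ?Q = "\<lambda>j. a \<in> ?S \<and> j \<in> ?S \<and> ratio st a j \<noteq> 0"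
  have M: "ratio st k l = (if k = l then 0 else pf w (flip k (flip l ?S)) / pf w ?S)" for k l
    using v by (auto simp: valid_def)
  have fin: "finite ?S" using v by (rule valid_finite)
  have "basis (remove n a st) \<subseteq> basis st - {a} \<and> card (basis st) \<le> card (basis (remove n a st)) + 2"
  proof (cases "a \<in> ?S")
    case False
    then have "remove n a st = st"
      using pick_cases[of n ?Q a] M[of a a] by (auto simp: remove_def pivot_def)
    then show ?thesis using False by simp
  next
    case True
    define Y where "Y = ?S - {a}"
    have Y: "?S = insert a Y" "a \<notin> Y" "finite Y" using True fin by (auto simp: Y_def)
    have "(\<Sum>k\<in>Y. w {a, k} * pf w (Y - {k})) \<noteq> 0"
      using v Y by (simp add: valid_def pf_insert)
    then obtain k where k: "k \<in> Y" "pf w (Y - {k}) \<noteq> 0"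
      by (metis (no_types, lifting) mult_eq_0_iff sum.neutral)
    have "flip a (flip k ?S) = Y - {k}" using k Y by (auto simp: flip_def)
    moreover have "a \<noteq> k" using k Y by auto
    ultimately have "ratio st a k \<noteq> 0" using k v by (simp add: M valid_def)
    moreover have "k < n" using v k Y by (auto simp: valid_def)
    ultimately have "?Q (pick n ?Q a)"
      using pick_cases[of n ?Q a] k Y by auto
    then obtain j where j: "j \<in> ?S" "ratio st a j \<noteq> 0" "remove n a st = pivot n a j st"
      by (auto simp: remove_def)
    then have "basis (remove n a st) = flip a (flip j ?S)" "a \<noteq> j"
      using M[of a j] by (auto simp: pivot_def)
    then show ?thesis
      using card_flip_flip(1)[OF fin, of a j] True j by (auto simp: in_flip_iff)
  qed
  then show "basis (remove n a st) \<subseteq> basis st - {a}" "card (basis st) \<le> card (basis (remove n a st)) + 2"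
    by auto
qed

text \<open>With \<open>a\<close> and \<open>b\<close> outside the basis \<open>S\<close>, the
  Pfaffian of \<open>S\<close> does not see the edge, and \<open>flip k (flip l S)\<close> contains
  both ends only for \<open>{k, l} = {a, b}\<close>. There \<open>pf_upd\<close> adds
  \<open>d * pf w S\<close>, so after division the ratio grows by exactly \<open>d\<close>. Loops
  are covered by the alternative \<open>d = 0\<close>.\<close>

lemma add_edge_valid:
  assumes v: "valid n w st" and ab: "a \<notin> basis st" "b \<notin> basis st" "a \<noteq> b \<or> d = 0"
  shows "valid n (w({a, b} := w {a, b} + d)) (add_edge a b d st)"
proof (cases "a = b")
  case True
  then show ?thesis using v ab by (simp add: add_edge_def valid_def)
next
  case False
  let ?S = "basis st" and ?w = "w({a, b} := w {a, b} + d)"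
  have fin: "finite ?S" using v by (rule valid_finite)
  have S: "pf ?w ?S = pf w ?S"
    using ab by (simp only: pf_upd[OF fin False]) simp
  have T: "pf ?w (flip k (flip l ?S)) = pf w (flip k (flip l ?S)) +
      (if k = a \<and> l = b \<or> k = b \<and> l = a then d * pf w ?S else 0)" if "k \<noteq> l" for k l
  proof -
    have "a \<in> flip k (flip l ?S) \<and> b \<in> flip k (flip l ?S) \<longleftrightarrow> k = a \<and> l = b \<or> k = b \<and> l = a"
      using ab False that by (auto simp: in_flip_iff)
    moreover have "flip k (flip l ?S) - {a, b} = ?S" if "k = a \<and> l = b \<or> k = b \<and> l = a"
      using ab False that by (auto simp: in_flip_iff)
    ultimately show ?thesis
      using fin by (simp add: pf_upd[OF _ False])
  qed
  show ?thesis
    using v False unfolding valid_def add_edge_def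
    by (auto simp: S T add_divide_distrib simp del: fun_upd_apply)
qed

lemma augment_valid: "valid n w st \<Longrightarrow> 0 < n \<Longrightarrow> valid n w (augment n st)"
  unfolding augment_def free_row_def free_column_def by (intro pivot_valid pick_lt)

text \<open>If no two free elements have a nonzero ratio, \<open>pf_augment\<close> shows that no
  feasible set is larger than the basis; otherwise the pivot at a free pair gains two
  elements.\<close>

lemma augment_card:
  assumes v: "valid n w st" and U: "U \<subseteq> {..<n}" "pf w U \<noteq> 0"
  shows "card U \<le> card (basis (augment n st)) \<or> card (basis st) + 2 \<le> card (basis (augment n st))"
    and "card (basis st) \<le> card (basis (augment n st))"
proof -
  let ?S = "basis st" and ?i = "free_row n st" and ?j = "free_column n st (free_row n st)"
  have M: "ratio st k l = (if k = l then 0 else pf w (flip k (flip l ?S)) / pf w ?S)" for k l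
    using v by (auto simp: valid_def)
  have fin: "finite ?S" using v by (rule valid_finite)
  have finU: "finite U" using U finite_subset by auto
  have "card U \<le> card ?S \<and> augment n st = st \<or> card (basis (augment n st)) = card ?S + 2"
  proof (cases "\<exists>i<n. i \<notin> ?S \<and> (\<exists>j<n. j \<notin> ?S \<and> ratio st i j \<noteq> 0)")
    case True
    then have "?i < n \<and> ?i \<notin> ?S \<and> (\<exists>j<n. j \<notin> ?S \<and> ratio st ?i j \<noteq> 0)"
      unfolding free_row_def by (rule pickI)
    then have i: "?i < n" "?i \<notin> ?S" "\<exists>j<n. ?i \<notin> ?S \<and> j \<notin> ?S \<and> ratio st ?i j \<noteq> 0"
      by simp_all
    then have "?j < n \<and> ?i \<notin> ?S \<and> ?j \<notin> ?S \<and> ratio st ?i ?j \<noteq> 0"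
      unfolding free_column_def by (intro pickI)
    then have j: "?j \<notin> ?S" "ratio st ?i ?j \<noteq> 0" by simp_all
    then have "?i \<noteq> ?j" using M[of ?i ?j] by auto
    then show ?thesis
      using card_flip_flip(2)[OF fin] i j by (simp add: augment_def pivot_def)
  next
    case False
    then have i: "?i = 0"
      unfolding free_row_def by (rule pick_default)
    have "\<not> (\<exists>j<n. ?i \<notin> ?S \<and> j \<notin> ?S \<and> ratio st ?i j \<noteq> 0)"
    proof
      assume *: "\<exists>j<n. ?i \<notin> ?S \<and> j \<notin> ?S \<and> ratio st ?i j \<noteq> 0"
      then have "?i < n" using i by auto
      with * False show False by auto
    qed
    then have "?j = ?i"
      unfolding free_column_def by (rule pick_default)
    then have "augment n st = st"
      using M[of ?i ?i] by (simp add: augment_def pivot_def)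
    moreover have "card U \<le> card ?S"
    proof (rule ccontr)
      assume "\<not> card U \<le> card ?S"
      then obtain i j where "i \<in> U - ?S" "j \<in> U - ?S" "i \<noteq> j" "pf w (flip i (flip j ?S)) \<noteq> 0"
        using pf_augment[OF fin _ finU U(2)] v by (auto simp: valid_def)
      then have "i < n" "i \<notin> ?S" "j < n" "j \<notin> ?S" "ratio st i j \<noteq> 0"
        using U v by (auto simp: M valid_def)
      then show False using False by metis
    qed
    ultimately show ?thesis by blast
  qed
  then show "card U \<le> card (basis (augment n st)) \<or> card (basis st) + 2 \<le> card (basis (augment n st))"
    and "card (basis st) \<le> card (basis (augment n st))" by auto
qed

theorem update_optimal:
  assumes opt: "optimal n w st" and ab: "a < n" "b < n" "a \<noteq> b \<or> d = 0"
  shows "optimal n (w({a, b} := w {a, b} + d)) (update n a b d st)"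
proof -
  let ?w = "w({a, b} := w {a, b} + d)"
  define s1 where "s1 = remove n a st"
  define s2 where "s2 = remove n b s1"
  define s3 where "s3 = add_edge a b d s2"
  have v: "valid n w st" using opt by (simp add: optimal_def)
  have v1: "valid n w s1" unfolding s1_def using v ab by (intro remove_valid)
  have v2: "valid n w s2" unfolding s2_def using v1 ab by (intro remove_valid)
  have out: "a \<notin> basis s2" "b \<notin> basis s2"
    using remove_basis(1)[OF v ab(1)] remove_basis(1)[OF v1 ab(2)] by (auto simp: s1_def s2_def)
  have v3: "valid n ?w s3" unfolding s3_def using v2 out ab by (intro add_edge_valid)
  have le: "card (basis st) \<le> card (basis s3) + 4"
    using remove_basis(2)[OF v ab(1)] remove_basis(2)[OF v1 ab(2)]
    by (simp add: s3_def s2_def s1_def add_edge_def)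
  have pos: "0 < n" using ab by simp
  note v4 = augment_valid[OF v3 pos]
  note v5 = augment_valid[OF v4 pos]
  have u: "update n a b d st = augment n (augment n (augment n s3))"
    by (simp add: update_def s1_def s2_def s3_def)
  have "card U \<le> card (basis (update n a b d st))" if U: "U \<subseteq> {..<n}" "pf ?w U \<noteq> 0" for U
  proof -
    have fin: "finite U" using U(1) finite_subset by blast
    \<comment> \<open>Either \<open>U\<close> was feasible before the change or, by
      \<open>pf_upd\<close>, \<open>U - {a, b}\<close> was.\<close>
    have "card U \<le> card (basis st) + 2"
    proof (cases "pf w U = 0")
      case False
      then show ?thesis using opt U by (auto simp: optimal_def intro: le_SucI)
    next
      case True
      have "a \<noteq> b" using True U ab by auto
      then have inU: "a \<in> U" "b \<in> U" "pf w (U - {a, b}) \<noteq> 0"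
        using True U(2) pf_upd[OF fin, of a b w d] by (auto split: if_splits)
      moreover have "U - {a, b} \<subseteq> {..<n}" using U(1) by auto
      ultimately have "card (U - {a, b}) \<le> card (basis st)" "card {a, b} \<le> card U"
        using opt U fin card_mono[of U "{a, b}"] by (auto simp: optimal_def)
      then show ?thesis
        using inU \<open>a \<noteq> b\<close> by (simp add: card_Diff_subset)
    qed
    then show ?thesis
      unfolding u using le augment_card[OF v3 U] augment_card[OF v4 U] augment_card[OF v5 U] by linarith
  qed
  then show ?thesis
    using augment_valid[OF v5 pos] u by (simp add: optimal_def)
qed

definition initial_state :: "'k::field_char2 local_state" where
  "initial_state = \<lparr>basis = {}, ratio = \<lambda>_ _. 0, half = 0\<rparr>"

lemma initial_optimal: "optimal n (\<lambda>_. 0) (initial_state :: 'k::field_char2 local_state)"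
proof -
  have zero: "pf (\<lambda>_. 0) S = (0 :: 'k)" if fin: "finite S" and ne: "S \<noteq> {}" for S :: "nat set"
  proof (rule ccontr)
    assume nz: "pf (\<lambda>_. 0) S \<noteq> (0 :: 'k)"
    obtain M where M: "M \<in> pairings S" "\<forall>e\<in>M. (0 :: 'k) \<noteq> 0"
      using pf_nonzeroD[OF fin nz] by metis
    then have "M = {}" by auto
    then show False using M(1) ne by (auto simp: pairings_def)
  qed
  have "flip i (flip j {}) \<noteq> {}" if "i \<noteq> j" for i j :: nat
    using that by (auto simp: flip_def)
  then have "pf (\<lambda>_. 0) (flip i (flip j {})) = (0 :: 'k)" if "i \<noteq> j" for i j :: nat
    using that by (simp add: zero)
  then have "valid n (\<lambda>_. 0) (initial_state :: 'k local_state)"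
    by (simp add: valid_def initial_state_def pf_empty)
  moreover have "card U \<le> card (basis (initial_state :: 'k local_state))"
    if U: "U \<subseteq> {..<n}" "pf (\<lambda>_. 0) U \<noteq> (0 :: 'k)" for U
  proof -
    have "U = {}" using zero[of U] U finite_subset[OF U(1)] by blast
    then show ?thesis by simp
  qed
  ultimately show ?thesis
    by (simp add: optimal_def)
qed

section \<open>Small fields and weights that suit every graph\<close>

instance bit :: field_char2
  by standard (simp flip: mult_2)

instance alg_closure :: (field_char2) field_char2
proof
  fix x :: "'a alg_closure"
  have "(1 :: 'a alg_closure) + 1 = to_ac (1 + 1)" by (simp only: to_ac_add to_ac_1)
  also have "\<dots> = 0" by (simp only: add_self to_ac_0)
  finally show "x + x = 0"
    by (metis mult_1 distrib_right mult_zero_left)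
qed

text \<open>As fixed-point sets of powers of the Frobenius map, the fields for all \<open>n\<close>
  live in one type, so that local states have one type too.\<close>

definition GF :: "nat \<Rightarrow> 'k::field_char2 set" where
  "GF k = {x. x ^ (2 ^ k) = x}"

lemma frobenius_add: "(x + y :: 'k::field_char2) ^ (2 ^ k) = x ^ (2 ^ k) + y ^ (2 ^ k)"
proof (induction k)
  case (Suc k)
  have sq: "(a + b) ^ 2 = a ^ 2 + b ^ 2" for a b :: 'k
  proof -
    have "(a + b) ^ 2 = a ^ 2 + b ^ 2 + (a * b + a * b)"
      by (simp add: power2_eq_square algebra_simps)
    then show ?thesis by (simp add: add_self)
  qed
  have "(x + y) ^ (2 ^ Suc k) = ((x + y) ^ (2 ^ k)) ^ 2"
    by (simp add: power_mult[symmetric] mult.commute)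
  then show ?case
    by (simp add: Suc sq power_mult[symmetric] mult.commute)
qed simp

lemma GF_closed:
  "0 \<in> GF k" "1 \<in> GF k" "x \<in> GF k \<Longrightarrow> y \<in> GF k \<Longrightarrow> x + y \<in> GF k"
  "x \<in> GF k \<Longrightarrow> y \<in> GF k \<Longrightarrow> x * y \<in> GF k" "x \<in> GF k \<Longrightarrow> inverse x \<in> GF k"
  by (simp_all add: GF_def frobenius_add power_mult_distrib power_inverse power_0_left)

text \<open>Over an algebraically closed field \<open>X ^ q - X\<close> with
  \<open>q = 2 ^ k\<close> splits into \<open>q\<close> linear factors. Its derivative is the
  constant \<open>-1\<close>, because \<open>q\<close> is zero in characteristic two, so no root is
  repeated.\<close>

lemma card_GF:
  assumes "0 < k"
  shows "card (GF k :: 'k::{field_char2, alg_closed_field} set) = 2 ^ k" "finite (GF k :: 'k set)"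
proof -
  let ?q = "2 ^ k :: nat"
  have q: "?q > 1" using one_less_power[of "2::nat" k] assms by simp
  define p :: "'k poly" where "p = monom 1 ?q - monom 1 1"
  have root: "poly p x = 0 \<longleftrightarrow> x \<in> GF k" for x
    by (simp add: p_def poly_monom GF_def)
  have deg: "degree p = ?q"
  proof -
    have "degree (monom (1::'k) 1) < degree (monom (1::'k) ?q)"
      using q by (simp add: degree_monom_eq)
    then show ?thesis
      using degree_add_eq_left[of "- monom 1 1" "monom (1::'k) ?q"] by (simp add: p_def degree_monom_eq)
  qed
  have lead: "lead_coeff p = 1"
    unfolding deg using q by (simp add: p_def)
  have "p \<noteq> 0" using lead by auto
  then obtain A where A: "size A = ?q" "p = (\<Prod>x\<in>#A. [:-x, 1:])"
    using alg_closed_imp_factorization[of p] lead deg by auto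
  have roots: "GF k = set_mset A"
    using root unfolding A(2) by (auto simp: poly_prod_mset image_iff)
  have "of_nat ?q = (0 :: 'k)"
    using assms add_self[of "1 :: 'k"] by (cases k) auto
  then have pd: "poly (pderiv p) x \<noteq> 0" for x
    using assms by (simp add: p_def pderiv_diff pderiv_monom power_0_left poly_monom)
  have "count A x = 1" if "x \<in># A" for x
  proof (rule ccontr)
    assume "count A x \<noteq> 1"
    moreover obtain B where B: "A = add_mset x B" using \<open>x \<in># A\<close> by (rule mset_add)
    ultimately have "x \<in># B" by (simp add: count_eq_zero_iff)
    then obtain C where "B = add_mset x C" by (rule mset_add)
    then have "p = [:-x, 1:] * ([:-x, 1:] * (\<Prod>y\<in>#C. [:-y, 1:]))" using A B by simp
    then have "poly (pderiv p) x = 0" by (simp only: pderiv_mult poly_add poly_mult) simp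
    then show False using pd by simp
  qed
  then have "card (set_mset A) = size A"
    unfolding size_multiset_overloaded_eq by simp
  then show "card (GF k :: 'k set) = 2 ^ k" "finite (GF k :: 'k set)"
    using A(1) roots by auto
qed

section \<open>Counting the weight assignments with vanishing Pfaffian\<close>

definition restrict_weight :: "'a set set \<Rightarrow> ('a set \<Rightarrow> 'k) \<Rightarrow> 'a set \<Rightarrow> 'k::field_char2" where
  "restrict_weight E x = (\<lambda>e. if e \<in> E then x e else 0)"

text \<open>Overwriting coordinate \<open>e\<close> maps pairs of a point with
  \<open>x e = g x\<close> and a value injectively into the whole space: since \<open>g\<close>
  ignores this coordinate, the overwritten entry can be recovered.\<close>

lemma card_determined_coordinate:
  assumes "finite P" "finite F" "e \<in> P" and g: "\<And>x c. g (x(e := c)) = g x"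
  shows "card {x \<in> P \<rightarrow>\<^sub>E F. x e = g x} * card F \<le> card (P \<rightarrow>\<^sub>E F)"
proof -
  let ?B = "{x \<in> P \<rightarrow>\<^sub>E F. x e = g x}"
  have "inj_on (\<lambda>(x, c). x(e := c)) (?B \<times> F)"
  proof (rule inj_onI, clarsimp)
    fix x c y d
    assume "x e = g x" "y e = g y" and eq: "x(e := c) = y(e := d)"
    have "g x = g y" using g[of x c] g[of y d] eq by simp
    with \<open>x e = g x\<close> \<open>y e = g y\<close> have "x e = y e" by simp
    moreover have "c = d" using fun_cong[OF eq, of e] by simp
    moreover have "x z = y z" if "z \<noteq> e" for z using fun_cong[OF eq, of z] that by simp
    ultimately show "x = y \<and> c = d" by (metis ext)
  qed
  moreover have "(\<lambda>(x, c). x(e := c)) ` (?B \<times> F) \<subseteq> P \<rightarrow>\<^sub>E F"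
    using assms(3) PiE_fun_upd[of _ "\<lambda>_. F" e _ P] by (auto simp: insert_absorb)
  ultimately have "card (?B \<times> F) \<le> card (P \<rightarrow>\<^sub>E F)"
    using assms by (intro card_inj_on_le) (auto intro: finite_PiE)
  then show ?thesis by (simp add: card_cartesian_product)
qed

text \<open>The Schwartz--Zippel bound: each edge of a perfect matching contributes one coordinate
  on which the Pfaffian depends linearly.\<close>

lemma card_pf_zero:
  assumes "finite P" "finite F" "E \<subseteq> P" "finite N" "N \<in> pairings U" "N \<subseteq> E"
  shows "card {x \<in> P \<rightarrow>\<^sub>E F. pf (restrict_weight E x) U = 0} * card F \<le> card N * card (P \<rightarrow>\<^sub>E (F :: 'k::field_char2 set))"
  using assms(4-6)
proof (induction N arbitrary: U)
  case empty
  then have "U = {}" by (auto simp: pairings_def)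
  then show ?case by (simp add: pf_empty)
next
  case (insert e N)
  let ?w = "restrict_weight E :: _ \<Rightarrow> _ \<Rightarrow> 'k" and ?O = "P \<rightarrow>\<^sub>E F"
  have finO: "finite ?O" using assms by (intro finite_PiE) auto
  obtain a b where e: "e = {a, b}" "a \<noteq> b"
    using insert.prems by (auto simp: pairings_def card_2_iff)
  define V where "V = \<Union>N"
  have dis: "e \<inter> V = {}"
    using insert.prems(1) insert.hyps(2) by (auto simp: pairings_def disjoint_def V_def)
  have U: "U = e \<union> V" using insert.prems by (auto simp: pairings_def V_def)
  have N: "N \<in> pairings V" using insert.prems by (auto simp: pairings_def V_def disjoint_def)
  have finV: "finite V" using insert.hyps insert.prems unfolding V_def
    by (intro finite_Union) (auto simp: pairings_def intro: card_ge_0_finite)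
  then have finU: "finite U" using U e by simp
  have UV: "U - {a, b} = V" using U e dis by auto
  \<comment> \<open>As a function of \<open>x e\<close> the Pfaffian of \<open>U\<close> is affine
    with slope the Pfaffian of \<open>V\<close>; where the slope is nonzero, \<open>g x\<close> is
    the only zero. Evaluation at \<open>x(e := 0)\<close> makes \<open>g\<close> independent of the
    coordinate.\<close>
  define g where "g x = pf (?w (x(e := 0))) U / pf (?w (x(e := 0))) V" for x :: "'a set \<Rightarrow> 'k"
  have g: "g (x(e := c)) = g x" for x c by (simp add: g_def)
  have "x e = g x" if "pf (?w x) U = 0" "pf (?w x) V \<noteq> 0" for x
  proof -
    let ?x = "x(e := 0)"
    have "?w x = (?w ?x)({a, b} := ?w ?x {a, b} + x e)"
      using e insert.prems by (auto simp: restrict_weight_def fun_eq_iff)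
    then have "pf (?w x) U = pf (?w ?x) U + x e * pf (?w ?x) V"
      using pf_upd[OF finU e(2), of "?w ?x" "x e"] U e UV by simp
    moreover have "pf (?w ?x) V = pf (?w x) V"
      using dis e by (intro pf_cong) (auto simp: restrict_weight_def)
    ultimately show ?thesis
      using that by (simp add: g_def add_eq_0_iff_eq field_simps)
  qed
  \<comment> \<open>Either the slope vanishes, which the induction hypothesis bounds, or one
    coordinate is determined, which happens with frequency at most
    \<open>1 / card F\<close>.\<close>
  then have "{x \<in> ?O. pf (?w x) U = 0} \<subseteq> {x \<in> ?O. pf (?w x) V = 0} \<union> {x \<in> ?O. x e = g x}"
    by blast
  then have "card {x \<in> ?O. pf (?w x) U = 0} \<le> card ({x \<in> ?O. pf (?w x) V = 0} \<union> {x \<in> ?O. x e = g x})"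
    using finO by (intro card_mono) auto
  also have "\<dots> \<le> card {x \<in> ?O. pf (?w x) V = 0} + card {x \<in> ?O. x e = g x}"
    by (rule card_Un_le)
  finally have "card {x \<in> ?O. pf (?w x) U = 0} * card F
      \<le> (card {x \<in> ?O. pf (?w x) V = 0} + card {x \<in> ?O. x e = g x}) * card F"
    by (rule mult_right_mono) simp
  also have "\<dots> \<le> card N * card ?O + card ?O"
    unfolding distrib_right
  proof (rule add_mono)
    show "card {x \<in> ?O. pf (?w x) V = 0} * card F \<le> card N * card ?O"
      using insert.IH[OF N] insert.prems by simp
    show "card {x \<in> ?O. x e = g x} * card F \<le> card ?O"
      by (rule card_determined_coordinate[OF assms(1,2)]) (use insert.prems assms(3) g in auto)
  qed
  finally show ?case using insert.hyps by simp
qed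

section \<open>Covering all graphs by few weight assignments\<close>

lemma sum_card_swap:
  assumes "finite A" "finite B"
  shows "(\<Sum>a\<in>A. card {b \<in> B. G a b}) = (\<Sum>b\<in>B. card {a \<in> A. G a b})"
proof -
  have "(\<Sum>a\<in>A. card {b \<in> B. G a b}) = (\<Sum>a\<in>A. \<Sum>b\<in>B. if G a b then 1 else 0)"
    using assms(2) by (simp add: sum.If_cases Int_def)
  also have "\<dots> = (\<Sum>b\<in>B. \<Sum>a\<in>A. if G a b then 1 else 0)"
    by (rule sum.swap)
  also have "\<dots> = (\<Sum>b\<in>B. card {a \<in> A. G a b})"
    using assms(1) by (simp add: sum.If_cases Int_def)
  finally show ?thesis .
qed

text \<open>Double counting of the pairs \<open>(t, x)\<close> with \<open>G t x\<close>: if every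
  point hit too few members of \<open>R\<close>, the total would be smaller than what the members
  together guarantee.\<close>

lemma averaging:
  assumes "finite \<Omega>" "\<Omega> \<noteq> {}" "finite R"
    and good: "\<And>t. t \<in> R \<Longrightarrow> card \<Omega> \<le> n * card {x \<in> \<Omega>. G t x}"
  obtains x where "x \<in> \<Omega>" "card R \<le> n * card {t \<in> R. G t x}"
proof -
  have "\<exists>x\<in>\<Omega>. card R \<le> n * card {t \<in> R. G t x}"
  proof (rule ccontr)
    assume "\<not> ?thesis"
    then have "(\<Sum>x\<in>\<Omega>. n * card {t \<in> R. G t x}) < (\<Sum>x\<in>\<Omega>. card R)"
      using assms by (intro sum_strict_mono) auto
    also have "\<dots> = (\<Sum>t\<in>R. card \<Omega>)" by simp
    also have "\<dots> \<le> (\<Sum>t\<in>R. n * card {x \<in> \<Omega>. G t x})"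
      by (intro sum_mono good)
    also have "\<dots> = (\<Sum>x\<in>\<Omega>. n * card {t \<in> R. G t x})"
      unfolding sum_distrib_left[symmetric] sum_card_swap[OF assms(3,1)] ..
    finally show False by simp
  qed
  then show ?thesis using that by auto
qed

text \<open>Each new point is chosen by \<open>averaging\<close> for the part still uncovered, which
  thereby shrinks by the factor \<open>1 - 1 / n\<close>. The powers of \<open>n\<close> and
  \<open>n - 1\<close> avoid fractions.\<close>

lemma greedy_cover:
  assumes "finite \<Omega>" "\<Omega> \<noteq> {}" "finite T"
    and good: "\<And>t. t \<in> T \<Longrightarrow> card \<Omega> \<le> n * card {x \<in> \<Omega>. G t x}"
  shows "\<exists>f. (\<forall>s. f s \<in> \<Omega>) \<and> card {t \<in> T. \<forall>s<m. \<not> G t (f s)} * n ^ m \<le> card T * (n - 1) ^ m"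
proof (induction m)
  case 0
  then show ?case using assms(2) by auto
next
  case (Suc m)
  then obtain f where f: "\<And>s. f s \<in> \<Omega>" "card {t \<in> T. \<forall>s<m. \<not> G t (f s)} * n ^ m \<le> card T * (n - 1) ^ m"
    by auto
  define R where "R = {t \<in> T. \<forall>s<m. \<not> G t (f s)}"
  have "finite R" using assms(3) by (simp add: R_def)
  obtain x where x: "x \<in> \<Omega>" "card R \<le> n * card {t \<in> R. G t x}"
    using averaging[OF assms(1,2) \<open>finite R\<close>, of n G] good by (auto simp: R_def)
  define R' where "R' = {t \<in> R. \<not> G t x}"
  have "card R = card {t \<in> R. G t x} + card R'"
    using \<open>finite R\<close> unfolding R'_def
    by (subst card_Un_disjoint[symmetric]) (auto intro: arg_cong[where f = card])
  with x(2) have "n * card R' \<le> (n - 1) * card R"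
    by (cases n) (auto simp: algebra_simps)
  then have "card R' * n ^ Suc m \<le> (n - 1) * (card R * n ^ m)"
    using mult_right_mono[of "n * card R'" "(n - 1) * card R" "n ^ m"] by (simp add: mult_ac)
  also have "\<dots> \<le> (n - 1) * (card T * (n - 1) ^ m)"
    using f(2) by (intro mult_left_mono) (auto simp: R_def)
  finally have "card R' * n ^ Suc m \<le> card T * (n - 1) ^ Suc m" by (simp add: mult_ac)
  moreover have "{t \<in> T. \<forall>s<Suc m. \<not> G t ((f(m := x)) s)} = R'"
    by (auto simp: R'_def R_def less_Suc_eq)
  ultimately show ?case
    using f(1) x(1) by (intro exI[of _ "f(m := x)"]) auto
qed

text \<open>This is \<open>(1 - 1 / n) ^ n \<le> 1 / 2\<close>, from Bernoulli's inequality
  \<open>(1 + 1 / m) ^ n \<ge> 1 + n / m \<ge> 2\<close> with \<open>m = n - 1\<close>.\<close>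

lemma two_times_pred_power: "2 * (n - 1) ^ n \<le> n ^ n" if "2 \<le> n" for n :: nat
proof -
  define m where "m = n - 1"
  have n: "n = Suc m" using that by (simp add: m_def)
  have "real m ^ n + real n * real m ^ m \<le> (real m + 1) ^ n"
  proof -
    have m: "real m > 0" using that by (simp add: m_def)
    have "1 + real n * (1 / real m) \<le> (1 + 1 / real m) ^ n"
      using m by (intro Bernoulli_inequality) (auto intro: order_trans[of _ 0])
    then have "real m ^ n * (1 + real n * (1 / real m)) \<le> real m ^ n * (1 + 1 / real m) ^ n"
      using m by (intro mult_left_mono) auto
    also have "\<dots> = (real m + 1) ^ n"
      using m by (simp add: power_mult_distrib[symmetric] distrib_left)
    finally show ?thesis using m by (simp add: n algebra_simps)
  qed
  moreover have "real m ^ n \<le> real n * real m ^ m" by (simp add: n mult_right_mono)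
  ultimately have "2 * real m ^ n \<le> (real m + 1) ^ n" by linarith
  moreover have "real m + 1 = real n" by (simp add: n)
  ultimately have "real (2 * m ^ n) \<le> real (n ^ n)" by simp
  then show ?thesis by (simp only: of_nat_le_iff m_def)
qed

definition all_pairs :: "nat \<Rightarrow> nat set set" where
  "all_pairs n = {e. e \<subseteq> {..<n} \<and> card e = 2}"

lemma finite_all_pairs: "finite (all_pairs n)"
  by (rule finite_subset[of _ "Pow {..<n}"]) (auto simp: all_pairs_def)

lemma card_all_pairs: "0 < n \<Longrightarrow> card (all_pairs n) < n * n"
proof -
  assume "0 < n"
  have "card (all_pairs n) = n choose 2"
    using n_subsets[of "{..<n}" 2] by (simp add: all_pairs_def)
  also have "\<dots> = n * (n - 1) div 2" by (rule choose_two)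
  also have "\<dots> \<le> n * (n - 1)" by simp
  also have "\<dots> < n * n" using \<open>0 < n\<close> by simp
  finally show ?thesis .
qed

definition matching_number :: "nat set set \<Rightarrow> nat" where
  "matching_number E = Max (card ` {M. matching E M})"

lemma finite_matchings: "finite E \<Longrightarrow> finite {M. matching E M}"
  by (rule finite_subset[of _ "Pow E"]) (auto simp: matching_def)

lemma matching_number_ge: "finite E \<Longrightarrow> matching E M \<Longrightarrow> card M \<le> matching_number E"
  unfolding matching_number_def using finite_matchings[of E] by (intro Max_ge) auto

lemma maximum_matching:
  assumes "finite E"
  obtains M where "matching E M" "card M = matching_number E"
proof -
  have "{} \<in> {M. matching E M}" by (simp add: matching_def)
  then have "matching_number E \<in> card ` {M. matching E M}"
    unfolding matching_number_def using finite_matchings[OF assms] by (intro Max_in) auto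
  then show ?thesis using that by auto
qed

lemma matching_pairings: "E \<subseteq> all_pairs n \<Longrightarrow> matching E M \<Longrightarrow> M \<in> pairings (\<Union>M)"
  by (auto simp: matching_def pairings_def all_pairs_def)

text \<open>For a fixed graph \<open>card_pf_zero\<close> bounds the bad fraction by
  \<open>(card F - 1) / card F\<close>, since a matching has at most \<open>n div 2 < card F\<close>
  edges. The good fraction is thus at least \<open>1 / card F \<ge> 1 / n\<close>, as
  \<open>greedy_cover\<close> requires.\<close>

lemma isolating_weights:
  fixes F :: "'k::field_char2 set"
  assumes n: "2 \<le> n" and F: "finite F" "card F \<le> n" "n < 2 * card F" "0 \<in> F"
  obtains W :: "nat \<Rightarrow> nat \<Rightarrow> nat \<Rightarrow> nat set \<Rightarrow> 'k"
  where "\<And>p q r e. W p q r e \<in> F"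
    and "\<And>E. E \<subseteq> all_pairs n \<Longrightarrow> \<exists>p<n. \<exists>q<n. \<exists>r<n. \<exists>U\<subseteq>{..<n}.
        card U = 2 * matching_number E \<and> pf (restrict_weight E (W p q r)) U \<noteq> 0"
proof -
  let ?P = "all_pairs n"
  define \<Omega> where "\<Omega> = ?P \<rightarrow>\<^sub>E F"
  define N where "N E = (SOME M. matching E M \<and> card M = matching_number E)" for E
  define G where "G E x \<longleftrightarrow> pf (restrict_weight E x) (\<Union>(N E)) \<noteq> 0" for E and x :: "nat set \<Rightarrow> 'k"
  have fin\<Omega>: "finite \<Omega>" unfolding \<Omega>_def using F finite_all_pairs by (intro finite_PiE) auto
  have ne\<Omega>: "\<Omega> \<noteq> {}" using F(4) by (auto simp: \<Omega>_def PiE_eq_empty_iff)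
  have NE: "matching E (N E)" "card (N E) = matching_number E" "N E \<in> pairings (\<Union>(N E))"
    "\<Union>(N E) \<subseteq> {..<n}" "card (\<Union>(N E)) = 2 * card (N E)" if "E \<subseteq> ?P" for E
  proof -
    have "finite E" using that finite_all_pairs finite_subset by blast
    from maximum_matching[OF this] show 1: "matching E (N E)" "card (N E) = matching_number E"
      unfolding N_def by (metis (mono_tags, lifting) someI_ex)+
    then show 2: "N E \<in> pairings (\<Union>(N E))" using matching_pairings that by blast
    show 3: "\<Union>(N E) \<subseteq> {..<n}" using 1 that by (auto simp: matching_def all_pairs_def)
    then show "card (\<Union>(N E)) = 2 * card (N E)"
      using 2 by (intro card_pairing) (auto intro: finite_subset)
  qed
  have good: "card \<Omega> \<le> n * card {x \<in> \<Omega>. G E x}" if "E \<in> Pow ?P" for E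
  proof -
    have E: "E \<subseteq> ?P" using that by simp
    let ?bad = "{x \<in> \<Omega>. pf (restrict_weight E x) (\<Union>(N E)) = 0}"
    have "finite (N E)" using NE(1)[OF E] E finite_all_pairs
      by (meson finite_subset matching_def)
    then have "card ?bad * card F \<le> card (N E) * card \<Omega>"
      unfolding \<Omega>_def using NE(1,3)[OF E] F finite_all_pairs E
      by (intro card_pf_zero) (auto simp: matching_def)
    also have "\<dots> \<le> (card F - 1) * card \<Omega>"
    proof (rule mult_right_mono)
      have "2 * card (N E) \<le> n" using NE(4,5)[OF E] by (metis card_lessThan card_mono finite_lessThan)
      then show "card (N E) \<le> card F - 1" using F by linarith
    qed simp
    finally have bad: "card ?bad * card F + card \<Omega> \<le> card F * card \<Omega>"
      using F(3) by (cases "card F") auto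
    have "card \<Omega> = card ?bad + card {x \<in> \<Omega>. G E x}"
      using fin\<Omega> unfolding G_def
      by (subst card_Un_disjoint[symmetric]) (auto intro: arg_cong[where f = card])
    then have "card F * card \<Omega> = card ?bad * card F + card F * card {x \<in> \<Omega>. G E x}"
      by (simp add: distrib_left mult.commute)
    with bad have "card \<Omega> \<le> card F * card {x \<in> \<Omega>. G E x}" by linarith
    also have "\<dots> \<le> n * card {x \<in> \<Omega>. G E x}" using F by (intro mult_right_mono) auto
    finally show ?thesis .
  qed
  \<comment> \<open>There are fewer than \<open>2 ^ (n * n)\<close> graphs, and every
    \<open>n\<close> rounds at least halve the bound on the uncovered ones, so \<open>n * n\<close>
    blocks of \<open>n\<close> rounds leave none.\<close>
  define m where "m = n * (n * n)"
  obtain f where f: "\<And>s. f s \<in> \<Omega>"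
    "card {E \<in> Pow ?P. \<forall>s<m. \<not> G E (f s)} * n ^ m \<le> card (Pow ?P) * (n - 1) ^ m"
    using greedy_cover[of \<Omega> "Pow ?P" n G m, OF fin\<Omega> ne\<Omega> _ good] finite_all_pairs by auto
  have "card (Pow ?P) * (n - 1) ^ m < 2 ^ (n * n) * (n - 1) ^ m"
    using card_all_pairs[of n] n by (simp add: card_Pow finite_all_pairs)
  also have "\<dots> = (2 * (n - 1) ^ n) ^ (n * n)"
    by (simp add: m_def power_mult power_mult_distrib)
  also have "\<dots> \<le> (n ^ n) ^ (n * n)"
    using two_times_pred_power[OF n] by (rule power_mono) simp
  also have "\<dots> = n ^ m" by (simp add: m_def power_mult)
  finally have "card {E \<in> Pow ?P. \<forall>s<m. \<not> G E (f s)} * n ^ m < 1 * n ^ m"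
    using f(2) unfolding mult_1 by (rule le_less_trans[rotated])
  then have "card {E \<in> Pow ?P. \<forall>s<m. \<not> G E (f s)} < 1" by (simp only: mult_less_cancel2)
  then have cover: "\<exists>s<m. G E (f s)" if "E \<subseteq> ?P" for E
  proof -
    have "{E \<in> Pow ?P. \<forall>s<m. \<not> G E (f s)} = {}"
      using \<open>card _ < 1\<close> finite_all_pairs by (simp add: card_eq_0_iff)
    with that show ?thesis by auto
  qed
  \<comment> \<open>The index of an assignment is read as a three-digit number in base
    \<open>n\<close>, so that it fits into three domain elements.\<close>
  define W where "W p q r e = (if e \<in> ?P then f (p * (n * n) + q * n + r) e else 0)" for p q r e
  show ?thesis
  proof
    show "W p q r e \<in> F" for p q r e
      using f(1) F(4) by (auto simp: W_def \<Omega>_def)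
    fix E assume E: "E \<subseteq> ?P"
    obtain s where s: "s < m" "G E (f s)" using cover[OF E] by auto
    let ?p = "s div (n * n)" and ?q = "s div n mod n" and ?r = "s mod n"
    have "s = ?p * (n * n) + ?q * n + ?r"
      by (metis add.assoc div_mult2_eq div_mult_mod_eq mult.assoc distrib_right)
    moreover have "?p < n" using s(1) unfolding m_def by (intro less_mult_imp_div_less) simp
    moreover have "?q < n" "?r < n" using n by auto
    moreover have "restrict_weight E (W ?p ?q ?r) = restrict_weight E (f s)"
      using E calculation(1) by (auto simp: restrict_weight_def W_def fun_eq_iff)
    ultimately show "\<exists>p<n. \<exists>q<n. \<exists>r<n. \<exists>U\<subseteq>{..<n}.
        card U = 2 * matching_number E \<and> pf (restrict_weight E (W p q r)) U \<noteq> 0"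
      using s(2) NE[OF E] unfolding G_def by metis
  qed
qed

section \<open>First-order definability\<close>

lemma finite_fv: "finite (fv \<phi>)"
  by (induction \<phi>) auto

lemma sat_cong_fv: "(\<And>x. x \<in> fv \<phi> \<Longrightarrow> v x = u x) \<Longrightarrow> sat n S v \<phi> = sat n S u \<phi>"
proof (induction \<phi> arbitrary: v u)
  case (Rel R xs)
  then have "map v xs = map u xs" by simp
  then show ?case by (simp only: sat.simps)
next
  case (Conj \<phi> \<psi>)
  then show ?case by (metis UnCI fv.simps(4) sat.simps(4))
next
  case (Disj \<phi> \<psi>)
  then show ?case by (metis UnCI fv.simps(5) sat.simps(5))
next
  case (Neg \<phi>)
  then show ?case by (metis fv.simps(3) sat.simps(3))
next
  case (Exi x \<phi>)
  have "sat n S (v(x := a)) \<phi> = sat n S (u(x := a)) \<phi>" for a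
    by (rule Exi.IH) (use Exi.prems in auto)
  then show ?case by simp
next
  case (Uni x \<phi>)
  have "sat n S (v(x := a)) \<phi> = sat n S (u(x := a)) \<phi>" for a
    by (rule Uni.IH) (use Uni.prems in auto)
  then show ?case by simp
qed simp

text \<open>Needed to use a formula under a different numbering of its variables. As
  \<open>f\<close> may identify variables, a bound variable is moved outside the image of the free
  variables, which prevents capture.\<close>

lemma ex_rename:
  "\<exists>\<psi>. wf_fo \<sigma> \<tau> \<psi> = wf_fo \<sigma> \<tau> \<phi> \<and> fv \<psi> \<subseteq> f ` fv \<phi> \<and> (\<forall>n S v. sat n S v \<psi> = sat n S (\<lambda>z. v (f z)) \<phi>)"
proof (induction \<phi> arbitrary: f)
  case (Eq x y)
  show ?case by (intro exI[of _ "Eq (f x) (f y)"]) auto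
next
  case (Rel R xs)
  show ?case by (intro exI[of _ "Rel R (map f xs)"]) (cases R; auto simp: comp_def)
next
  case (Neg \<phi>)
  then obtain \<psi> where "wf_fo \<sigma> \<tau> \<psi> = wf_fo \<sigma> \<tau> \<phi>" "fv \<psi> \<subseteq> f ` fv \<phi>"
    "\<forall>n S v. sat n S v \<psi> = sat n S (\<lambda>z. v (f z)) \<phi>" by metis
  then show ?case by (intro exI[of _ "Neg \<psi>"]) simp
next
  case (Conj \<phi>1 \<phi>2)
  obtain \<psi>1 where "wf_fo \<sigma> \<tau> \<psi>1 = wf_fo \<sigma> \<tau> \<phi>1" "fv \<psi>1 \<subseteq> f ` fv \<phi>1"
    "\<forall>n S v. sat n S v \<psi>1 = sat n S (\<lambda>z. v (f z)) \<phi>1" using Conj.IH(1) by metis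
  moreover obtain \<psi>2 where "wf_fo \<sigma> \<tau> \<psi>2 = wf_fo \<sigma> \<tau> \<phi>2" "fv \<psi>2 \<subseteq> f ` fv \<phi>2"
    "\<forall>n S v. sat n S v \<psi>2 = sat n S (\<lambda>z. v (f z)) \<phi>2" using Conj.IH(2) by metis
  ultimately show ?case by (intro exI[of _ "Conj \<psi>1 \<psi>2"]) auto
next
  case (Disj \<phi>1 \<phi>2)
  obtain \<psi>1 where "wf_fo \<sigma> \<tau> \<psi>1 = wf_fo \<sigma> \<tau> \<phi>1" "fv \<psi>1 \<subseteq> f ` fv \<phi>1"
    "\<forall>n S v. sat n S v \<psi>1 = sat n S (\<lambda>z. v (f z)) \<phi>1" using Disj.IH(1) by metis
  moreover obtain \<psi>2 where "wf_fo \<sigma> \<tau> \<psi>2 = wf_fo \<sigma> \<tau> \<phi>2" "fv \<psi>2 \<subseteq> f ` fv \<phi>2"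
    "\<forall>n S v. sat n S v \<psi>2 = sat n S (\<lambda>z. v (f z)) \<phi>2" using Disj.IH(2) by metis
  ultimately show ?case by (intro exI[of _ "Disj \<psi>1 \<psi>2"]) auto
next
  case (Exi x \<phi>)
  obtain y where y: "y \<notin> f ` fv \<phi>"
    using ex_new_if_finite[of "f ` fv \<phi>"] finite_fv by auto
  obtain \<psi> where \<psi>: "wf_fo \<sigma> \<tau> \<psi> = wf_fo \<sigma> \<tau> \<phi>" "fv \<psi> \<subseteq> (f(x := y)) ` fv \<phi>"
    "\<forall>n S v. sat n S v \<psi> = sat n S (\<lambda>z. v ((f(x := y)) z)) \<phi>" using Exi.IH by metis
  have "sat n S (\<lambda>z. (v(y := a)) ((f(x := y)) z)) \<phi> = sat n S ((\<lambda>z. v (f z))(x := a)) \<phi>" for n S v a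
    using y by (intro sat_cong_fv) auto
  then show ?case using \<psi> by (intro exI[of _ "Exi y \<psi>"]) auto
next
  case (Uni x \<phi>)
  obtain y where y: "y \<notin> f ` fv \<phi>"
    using ex_new_if_finite[of "f ` fv \<phi>"] finite_fv by auto
  obtain \<psi> where \<psi>: "wf_fo \<sigma> \<tau> \<psi> = wf_fo \<sigma> \<tau> \<phi>" "fv \<psi> \<subseteq> (f(x := y)) ` fv \<phi>"
    "\<forall>n S v. sat n S v \<psi> = sat n S (\<lambda>z. v ((f(x := y)) z)) \<phi>" using Uni.IH by metis
  have "sat n S (\<lambda>z. (v(y := a)) ((f(x := y)) z)) \<phi> = sat n S ((\<lambda>z. v (f z))(x := a)) \<phi>" for n S v a
    using y by (intro sat_cong_fv) auto
  then show ?case using \<psi> by (intro exI[of _ "Uni y \<psi>"]) auto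
qed

text \<open>
  Definability of a predicate \<open>P\<close> on contexts \<open>c\<close>: the structure is read off from the state
  \<open>st c\<close> and the free variables of the formula have the values \<open>t c\<close> for \<open>t\<close> in \<open>ts\<close>.
  A quantifier enlarges a context \<open>c\<close> to a pair \<open>(c, a)\<close>.
\<close>

locale fo_states =
  fixes \<sigma> \<tau> :: schema
    and size_of :: "'s \<Rightarrow> nat"
    and str :: "'s \<Rightarrow> relsym \<Rightarrow> nat list set"
    and good :: "'s set"
begin

definition contexts :: "('c \<Rightarrow> 's) \<Rightarrow> ('c \<Rightarrow> nat) list \<Rightarrow> 'c set" where
  "contexts st ts = {c. st c \<in> good \<and> (\<forall>t\<in>set ts. t c < size_of (st c))}"

definition definable :: "('c \<Rightarrow> 's) \<Rightarrow> ('c \<Rightarrow> nat) list \<Rightarrow> ('c \<Rightarrow> bool) \<Rightarrow> bool" where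
  "definable st ts P \<longleftrightarrow>
    (\<exists>\<phi>. wf_fo \<sigma> \<tau> \<phi> \<and> fv \<phi> \<subseteq> {..<length ts} \<and>
      (\<forall>c\<in>contexts st ts. \<forall>v. (\<forall>i<length ts. v i = (ts ! i) c) \<longrightarrow>
        sat (size_of (st c)) (str (st c)) v \<phi> = P c))"

text \<open>The bound variable comes last, so the old variables keep their positions and the new one
  has index \<open>length ts\<close>.\<close>

definition ext :: "('c \<Rightarrow> nat) list \<Rightarrow> ('c \<times> nat \<Rightarrow> nat) list" where
  "ext ts = map (\<lambda>t x. t (fst x)) ts @ [snd]"

lemma length_ext [simp]: "length (ext ts) = Suc (length ts)"
  by (simp add: ext_def)

lemma ext_old [simp, intro]: "t \<in> set ts \<Longrightarrow> (\<lambda>x. t (fst x)) \<in> set (ext ts)"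
  by (auto simp: ext_def)

lemma ext_new [simp, intro]: "snd \<in> set (ext ts)"
  by (auto simp: ext_def)

lemma ext_new2 [simp, intro]: "(\<lambda>x. snd (fst x)) \<in> set (ext (ext ts))"
  by (rule ext_old) simp

lemma ext_new3 [simp, intro]: "(\<lambda>x. snd (fst (fst x))) \<in> set (ext (ext (ext ts)))"
  by (rule ext_old) simp

lemma in_contexts_ext:
  "x \<in> contexts (\<lambda>x. st (fst x)) (ext ts) \<longleftrightarrow> fst x \<in> contexts st ts \<and> snd x < size_of (st (fst x))"
  by (auto simp: contexts_def ext_def)

lemma in_contexts_ext2:
  "x \<in> contexts (\<lambda>x. st (fst (fst x))) (ext (ext ts)) \<longleftrightarrow>
    fst (fst x) \<in> contexts st ts \<and> snd (fst x) < size_of (st (fst (fst x))) \<and> snd x < size_of (st (fst (fst x)))"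
  by (auto simp: contexts_def ext_def)

lemma in_contexts_ext3:
  "x \<in> contexts (\<lambda>x. st (fst (fst (fst x)))) (ext (ext (ext ts))) \<longleftrightarrow>
    fst (fst (fst x)) \<in> contexts st ts \<and> snd (fst (fst x)) < size_of (st (fst (fst (fst x)))) \<and>
    snd (fst x) < size_of (st (fst (fst (fst x)))) \<and> snd x < size_of (st (fst (fst (fst x))))"
  by (auto simp: contexts_def ext_def)

lemma definable_cong:
  assumes "definable st ts P" "\<And>c. c \<in> contexts st ts \<Longrightarrow> P c = Q c"
  shows "definable st ts Q"
  using assms unfolding definable_def by (metis (no_types, lifting))

text \<open>Carries a definition over to other contexts: along \<open>h\<close>, variables may be
  permuted, repeated or added, as long as each old variable is one of the new ones.\<close>

lemma definable_substitute:
  assumes P: "definable st ts P" and st: "\<And>d. st' d = st (h d)"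
    and vars: "\<And>t. t \<in> set ts \<Longrightarrow> (\<lambda>d. t (h d)) \<in> set us"
  shows "definable st' us (\<lambda>d. P (h d))"
proof -
  obtain \<phi> where \<phi>: "wf_fo \<sigma> \<tau> \<phi>" "fv \<phi> \<subseteq> {..<length ts}"
    "\<And>c v. c \<in> contexts st ts \<Longrightarrow> (\<forall>i<length ts. v i = (ts ! i) c) \<Longrightarrow>
        sat (size_of (st c)) (str (st c)) v \<phi> = P c"
    using P unfolding definable_def by blast
  have "\<exists>j. j < length us \<and> us ! j = (\<lambda>d. (ts ! i) (h d))" if "i < length ts" for i
    using vars[OF nth_mem[OF that]] by (auto simp: in_set_conv_nth)
  then obtain f where f: "\<And>i. i < length ts \<Longrightarrow> f i < length us \<and> us ! f i = (\<lambda>d. (ts ! i) (h d))"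
    by metis
  obtain \<psi> where \<psi>: "wf_fo \<sigma> \<tau> \<psi> = wf_fo \<sigma> \<tau> \<phi>" "fv \<psi> \<subseteq> f ` fv \<phi>"
    "\<And>n S v. sat n S v \<psi> = sat n S (\<lambda>z. v (f z)) \<phi>" using ex_rename by metis
  have h: "h d \<in> contexts st ts" if "d \<in> contexts st' us" for d
    using that vars by (fastforce simp: contexts_def st)
  have "sat (size_of (st' d)) (str (st' d)) v \<psi> = P (h d)"
    if "d \<in> contexts st' us" "\<forall>i<length us. v i = (us ! i) d" for d v
    using \<phi>(3)[OF h[OF that(1)], of "\<lambda>z. v (f z)"] that(2) f by (simp add: \<psi>(3) st)
  moreover have "fv \<psi> \<subseteq> {..<length us}" using \<psi>(2) \<phi>(2) f by fastforce
  ultimately show ?thesis unfolding definable_def using \<psi>(1) \<phi>(1) by blast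
qed

lemma definable_fst:
  "definable st ts P \<Longrightarrow> definable (\<lambda>x. st (fst x)) (ext ts) (\<lambda>x. P (fst x))"
  by (rule definable_substitute) auto

lemma definable_eq:
  assumes "t \<in> set ts" "u \<in> set ts"
  shows "definable st ts (\<lambda>c. t c = u c)"
proof -
  obtain i j where "i < length ts" "t = ts ! i" "j < length ts" "u = ts ! j"
    using assms by (auto simp: in_set_conv_nth)
  then show ?thesis unfolding definable_def by (intro exI[of _ "Eq i j"]) auto
qed

lemma definable_rel:
  assumes "set us \<subseteq> set ts"
    "case R of Inp i \<Rightarrow> i < length \<sigma> \<and> length us = \<sigma> ! i | Aux j \<Rightarrow> j < length \<tau> \<and> length us = \<tau> ! j"
  shows "definable st ts (\<lambda>c. map (\<lambda>u. u c) us \<in> str (st c) R)"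
proof -
  have "\<forall>u\<in>set us. \<exists>i. i < length ts \<and> ts ! i = u"
    using assms(1) by (auto simp: in_set_conv_nth)
  then obtain f where f: "\<And>u. u \<in> set us \<Longrightarrow> f u < length ts \<and> ts ! f u = u"
    by metis
  have m: "map v (map f us) = map (\<lambda>u. u c) us" if "\<forall>i<length ts. v i = (ts ! i) c" for v c
    using f that by simp
  have "wf_fo \<sigma> \<tau> (Rel R (map f us))" using assms(2) by (cases R) auto
  moreover have "fv (Rel R (map f us)) \<subseteq> {..<length ts}" using f by auto
  moreover have "sat (size_of (st c)) (str (st c)) v (Rel R (map f us)) = (map (\<lambda>u. u c) us \<in> str (st c) R)"
    if "\<forall>i<length ts. v i = (ts ! i) c" for v c
    unfolding sat.simps m[OF that] ..
  ultimately show ?thesis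
    unfolding definable_def by (intro exI[of _ "Rel R (map f us)"]) simp
qed

lemma definable_not: "definable st ts P \<Longrightarrow> definable st ts (\<lambda>c. \<not> P c)"
proof -
  assume "definable st ts P"
  then obtain \<phi> where
    "wf_fo \<sigma> \<tau> \<phi> \<and> fv \<phi> \<subseteq> {..<length ts} \<and> (\<forall>c\<in>contexts st ts. \<forall>v. (\<forall>i<length ts. v i = (ts ! i) c) \<longrightarrow>
        sat (size_of (st c)) (str (st c)) v \<phi> = P c)"
    unfolding definable_def by metis
  then show ?thesis
    unfolding definable_def by (intro exI[of _ "Neg \<phi>"]) simp
qed

lemma definable_conj: "definable st ts P \<Longrightarrow> definable st ts Q \<Longrightarrow> definable st ts (\<lambda>c. P c \<and> Q c)"
proof -
  assume "definable st ts P" "definable st ts Q"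
  then obtain \<phi> \<psi> where
    "wf_fo \<sigma> \<tau> \<phi> \<and> fv \<phi> \<subseteq> {..<length ts} \<and> (\<forall>c\<in>contexts st ts. \<forall>v. (\<forall>i<length ts. v i = (ts ! i) c) \<longrightarrow>
        sat (size_of (st c)) (str (st c)) v \<phi> = P c)"
    "wf_fo \<sigma> \<tau> \<psi> \<and> fv \<psi> \<subseteq> {..<length ts} \<and> (\<forall>c\<in>contexts st ts. \<forall>v. (\<forall>i<length ts. v i = (ts ! i) c) \<longrightarrow>
        sat (size_of (st c)) (str (st c)) v \<psi> = Q c)"
    unfolding definable_def by metis
  then show ?thesis
    unfolding definable_def by (intro exI[of _ "Conj \<phi> \<psi>"]) simp
qed

lemma definable_disj: "definable st ts P \<Longrightarrow> definable st ts Q \<Longrightarrow> definable st ts (\<lambda>c. P c \<or> Q c)"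
  using definable_not[OF definable_conj[OF definable_not definable_not], of st ts P Q] by simp

lemma definable_imp: "definable st ts P \<Longrightarrow> definable st ts Q \<Longrightarrow> definable st ts (\<lambda>c. P c \<longrightarrow> Q c)"
  using definable_disj[OF definable_not, of st ts P Q] by simp

lemma definable_if:
  "definable st ts P \<Longrightarrow> definable st ts Q \<Longrightarrow> definable st ts R \<Longrightarrow>
    definable st ts (\<lambda>c. if P c then Q c else R c)"
  using definable_conj[OF definable_imp[of st ts P Q] definable_imp[OF definable_not[of st ts P], of R]]
  by (simp add: if_bool_eq_conj)

lemma definable_ex:
  assumes "definable (\<lambda>x. st (fst x)) (ext ts) (\<lambda>x. P (fst x) (snd x))"
  shows "definable st ts (\<lambda>c. \<exists>a<size_of (st c). P c a)"
proof -
  obtain \<phi> where \<phi>: "wf_fo \<sigma> \<tau> \<phi>" "fv \<phi> \<subseteq> {..<Suc (length ts)}"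
    "\<And>x v. x \<in> contexts (\<lambda>x. st (fst x)) (ext ts) \<Longrightarrow> (\<forall>i<Suc (length ts). v i = (ext ts ! i) x) \<Longrightarrow>
        sat (size_of (st (fst x))) (str (st (fst x))) v \<phi> = P (fst x) (snd x)"
    using assms unfolding definable_def length_ext by blast
  let ?k = "length ts"
  have "sat (size_of (st c)) (str (st c)) (v(?k := a)) \<phi> = P c a"
    if "c \<in> contexts st ts" "\<forall>i<?k. v i = (ts ! i) c" "a < size_of (st c)" for c v a
    using \<phi>(3)[of "(c, a)" "v(?k := a)"] that
    by (simp add: in_contexts_ext) (simp add: ext_def nth_append)
  then show ?thesis
    unfolding definable_def using \<phi>(1,2) by (intro exI[of _ "Exi ?k \<phi>"]) auto
qed

lemma definable_all:
  assumes "definable (\<lambda>x. st (fst x)) (ext ts) (\<lambda>x. P (fst x) (snd x))"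
  shows "definable st ts (\<lambda>c. \<forall>a<size_of (st c). P c a)"
  using definable_not[OF definable_ex[OF definable_not[OF assms]]] by simp

text \<open>Formulas have no function symbols, so a number-valued term is represented by its graph;
  the bound ensures that a quantifier over the domain meets the value.\<close>

definition definable_nat :: "('c \<Rightarrow> 's) \<Rightarrow> ('c \<Rightarrow> nat) list \<Rightarrow> ('c \<Rightarrow> nat) \<Rightarrow> bool" where
  "definable_nat st ts g \<longleftrightarrow> (\<forall>c\<in>contexts st ts. g c < size_of (st c)) \<and>
    definable (\<lambda>x. st (fst x)) (ext ts) (\<lambda>x. snd x = g (fst x))"

lemma definable_nat_substitute:
  assumes g: "definable_nat st ts g" and st: "\<And>d. st' d = st (h d)"
    and vars: "\<And>t. t \<in> set ts \<Longrightarrow> (\<lambda>d. t (h d)) \<in> set us"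
  shows "definable_nat st' us (\<lambda>d. g (h d))"
proof -
  have "h d \<in> contexts st ts" if "d \<in> contexts st' us" for d
    using that vars by (fastforce simp: contexts_def st)
  moreover have "definable (\<lambda>x. st' (fst x)) (ext us)
      (\<lambda>x. snd (h (fst x), snd x) = g (fst (h (fst x), snd x)))"
    using g unfolding definable_nat_def
    by (elim conjE, elim definable_substitute[where h = "\<lambda>x. (h (fst x), snd x)"])
      (auto simp: st ext_def dest: vars intro: image_eqI[where x = "\<lambda>d. t (h d)" for t])
  ultimately show ?thesis using g by (simp add: definable_nat_def st)
qed

lemma definable_nat_fst:
  "definable_nat st ts g \<Longrightarrow> definable_nat (\<lambda>x. st (fst x)) (ext ts) (\<lambda>x. g (fst x))"
  by (rule definable_nat_substitute) auto

lemma definable_nat_var: "t \<in> set ts \<Longrightarrow> definable_nat st ts t"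
  unfolding definable_nat_def by (auto simp: contexts_def intro!: definable_eq)

text \<open>Substitution of a term for a variable: the formula quantifies over the value of the
  term.\<close>

lemma definable_let:
  assumes g: "definable_nat st ts g" and P: "definable (\<lambda>x. st (fst x)) (ext ts) (\<lambda>x. P (fst x) (snd x))"
  shows "definable st ts (\<lambda>c. P c (g c))"
proof (rule definable_cong)
  show "definable st ts (\<lambda>c. \<exists>a<size_of (st c). a = g c \<and> P c a)"
    using g P by (intro definable_ex definable_conj) (simp_all add: definable_nat_def)
  show "(\<exists>a<size_of (st c). a = g c \<and> P c a) = P c (g c)" if "c \<in> contexts st ts" for c
    using g that by (auto simp: definable_nat_def)
qed

lemma definable_let2:
  assumes "definable_nat st ts g" "definable_nat st ts h"
    and "definable (\<lambda>x. st (fst (fst x))) (ext (ext ts)) (\<lambda>x. P (fst (fst x)) (snd (fst x)) (snd x))"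
  shows "definable st ts (\<lambda>c. P c (g c) (h c))"
  using definable_let[OF assms(1), of "\<lambda>c a. P c a (h c)"]
    definable_let[OF definable_nat_fst[OF assms(2)], of "\<lambda>x b. P (fst x) (snd x) b"] assms(3)
  by simp

lemma definable_nat_eq:
  "definable_nat st ts g \<Longrightarrow> definable_nat st ts h \<Longrightarrow> definable st ts (\<lambda>c. g c = h c)"
  by (rule definable_let2[where P = "\<lambda>_ a b. a = b"]) (auto intro!: definable_eq)

lemma definable_natI:
  assumes "\<And>c. c \<in> contexts st ts \<Longrightarrow> g c < size_of (st c)"
    "definable (\<lambda>x. st (fst x)) (ext ts) (\<lambda>x. snd x = g (fst x))"
  shows "definable_nat st ts g"
  using assms by (simp add: definable_nat_def)

lemma definable_nat_cong:
  assumes "definable_nat st ts f" "\<And>c. c \<in> contexts st ts \<Longrightarrow> f c = g c"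
  shows "definable_nat st ts g"
  using assms unfolding definable_nat_def
  by (auto simp: in_contexts_ext intro: definable_cong)

lemma definable_nat_let:
  assumes g: "definable_nat st ts g" and f: "definable_nat (\<lambda>x. st (fst x)) (ext ts) (\<lambda>x. f (fst x) (snd x))"
  shows "definable_nat st ts (\<lambda>c. f c (g c))"
proof (rule definable_natI)
  have "(c, g c) \<in> contexts (\<lambda>x. st (fst x)) (ext ts)" if "c \<in> contexts st ts" for c
    using g that by (simp add: in_contexts_ext definable_nat_def)
  then show "f c (g c) < size_of (st c)" if "c \<in> contexts st ts" for c
    using f that by (fastforce simp: definable_nat_def)
  \<comment> \<open>The map goes from \<open>((c, z), a)\<close> to \<open>((c, a), z)\<close>: the
    argument of \<open>f\<close> is bound last here, but precedes the value in the graph of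
    \<open>f\<close>.\<close>
  have "definable (\<lambda>x. st (fst (fst x))) (ext (ext ts))
      (\<lambda>x. snd ((fst (fst x), snd x), snd (fst x)) = f (fst (fst ((fst (fst x), snd x), snd (fst x)))) (snd (fst ((fst (fst x), snd x), snd (fst x)))))"
    using f unfolding definable_nat_def
    by (elim conjE, elim definable_substitute[where h = "\<lambda>x. ((fst (fst x), snd x), snd (fst x))"])
      (auto simp: ext_def image_image)
  then show "definable (\<lambda>x. st (fst x)) (ext ts) (\<lambda>x. snd x = f (fst x) (g (fst x)))"
    using definable_let[OF definable_nat_fst[OF g], of "\<lambda>x a. snd x = f (fst x) a"] by simp
qed

lemma definable_nat_if:
  assumes "definable st ts P" "definable_nat st ts f" "definable_nat st ts g"
  shows "definable_nat st ts (\<lambda>c. if P c then f c else g c)"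
proof (rule definable_natI)
  show "(if P c then f c else g c) < size_of (st c)" if "c \<in> contexts st ts" for c
    using assms that by (simp add: definable_nat_def)
  have "definable (\<lambda>x. st (fst x)) (ext ts) (\<lambda>x. if P (fst x) then snd x = f (fst x) else snd x = g (fst x))"
    using assms by (intro definable_if definable_fst) (simp_all add: definable_nat_def)
  then show "definable (\<lambda>x. st (fst x)) (ext ts) (\<lambda>x. snd x = (if P (fst x) then f (fst x) else g (fst x)))"
    by (rule definable_cong) simp
qed

end

section \<open>Definability of a single update\<close>

record 'k dyn_state =
  domain_size :: nat
  input_rels :: relations
  answer_rel :: "nat list set"
  locals :: "nat \<Rightarrow> nat \<Rightarrow> nat \<Rightarrow> 'k local_state"

text \<open>In the order of \<open>encode\<close>: the answer; bases, ratios and halves, each tuple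
  led by the triple that names the assignment; the weights; addition, multiplication and inverse in
  the field, its zero and one; order and successor; and \<open>Res\<close>. Only the first four
  relations change with the input when \<open>n \<ge> 2\<close>.\<close>

definition aux_arities :: "nat \<Rightarrow> schema" where
  "aux_arities r = [r, 4, 6, 4, 6, 3, 3, 2, 1, 1, 2, 2, Suc r]"

text \<open>\<open>Res n\<close> is meant to contain \<open>m # bs\<close> when \<open>bs\<close>
  belongs to the answer at matching number \<open>m\<close>; with this precomputed table one
  construction serves both queries. \<open>cod n\<close> names the elements of the field
  \<open>F n\<close> by domain elements. The conditions on the field start at \<open>n = 2\<close>,
  where \<open>0\<close> and \<open>1\<close> first have room.\<close>

locale matching_fo =
  fixes r :: nat
    and Res :: "nat \<Rightarrow> nat list set"
    and F :: "nat \<Rightarrow> 'k::field_char2 set"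
    and cod :: "nat \<Rightarrow> 'k \<Rightarrow> nat"
    and W :: "nat \<Rightarrow> nat \<Rightarrow> nat \<Rightarrow> nat \<Rightarrow> nat set \<Rightarrow> 'k"
  assumes F_zero: "2 \<le> n \<Longrightarrow> 0 \<in> F n" and F_one: "2 \<le> n \<Longrightarrow> 1 \<in> F n"
    and F_add: "2 \<le> n \<Longrightarrow> x \<in> F n \<Longrightarrow> y \<in> F n \<Longrightarrow> x + y \<in> F n"
    and F_mult: "2 \<le> n \<Longrightarrow> x \<in> F n \<Longrightarrow> y \<in> F n \<Longrightarrow> x * y \<in> F n"
    and F_inverse: "2 \<le> n \<Longrightarrow> x \<in> F n \<Longrightarrow> inverse x \<in> F n"
    and cod_inj: "2 \<le> n \<Longrightarrow> inj_on (cod n) (F n)"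
    and cod_less: "2 \<le> n \<Longrightarrow> x \<in> F n \<Longrightarrow> cod n x < n"
    and W_in_F: "2 \<le> n \<Longrightarrow> W n p q t e \<in> F n"
    and Res_tuples: "Res n \<subseteq> tuples n (Suc r)"
begin

definition encode :: "nat \<Rightarrow> nat list set \<Rightarrow> (nat \<Rightarrow> nat \<Rightarrow> nat \<Rightarrow> 'k local_state) \<Rightarrow> relations" where
  "encode n A L j =
    (if j < 13 then
      [A,
       {[p, q, t, i] | p q t i. p < n \<and> q < n \<and> t < n \<and> i \<in> basis (L p q t)},
       {[p, q, t, i, j, cod n (ratio (L p q t) i j)] | p q t i j. p < n \<and> q < n \<and> t < n \<and> i < n \<and> j < n},
       {[p, q, t, half (L p q t)] | p q t. p < n \<and> q < n \<and> t < n},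
       {[p, q, t, a, b, cod n (W n p q t {a, b})] | p q t a b. p < n \<and> q < n \<and> t < n \<and> a < n \<and> b < n},
       {[cod n x, cod n y, cod n (x + y)] | x y. x \<in> F n \<and> y \<in> F n},
       {[cod n x, cod n y, cod n (x * y)] | x y. x \<in> F n \<and> y \<in> F n},
       {[cod n x, cod n (inverse x)] | x. x \<in> F n},
       {[cod n 0]}, {[cod n 1]},
       {[x, y] | x y. x < y \<and> y < n}, {[x, Suc x] | x. Suc x < n},
       Res n] ! j
     else {})"

definition structure_of :: "'k dyn_state \<Rightarrow> relsym \<Rightarrow> nat list set" where
  "structure_of s = interp (input_rels s) (encode (domain_size s) (answer_rel s) (locals s))"

text \<open>Weaker than \<open>valid\<close>: just what is needed to write a local state into
  relations. The definability proofs work on all such states; optimality enters only with the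
  correctness of runs.\<close>

definition good_local :: "nat \<Rightarrow> 'k local_state \<Rightarrow> bool" where
  "good_local n l \<longleftrightarrow> basis l \<subseteq> {..<n} \<and> (\<forall>i j. ratio l i j \<in> F n) \<and> half l < n"

definition good_states :: "'k dyn_state set" where
  "good_states = {s. 2 \<le> domain_size s \<and> (\<forall>p q t. good_local (domain_size s) (locals s p q t))}"

sublocale fo_states graph_schema "aux_arities r" domain_size structure_of good_states .

lemma contexts_ge_2: "c \<in> contexts st ts \<Longrightarrow> 2 \<le> domain_size (st c)"
  by (simp only: contexts_def mem_Collect_eq) (simp add: good_states_def)

lemma cod_eq_iff: "2 \<le> n \<Longrightarrow> x \<in> F n \<Longrightarrow> y \<in> F n \<Longrightarrow> cod n x = cod n y \<longleftrightarrow> x = y"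
  by (rule inj_on_eq_iff[OF cod_inj])

lemma structure_of_consts:
  "structure_of s (Aux 5) = {[cod n x, cod n y, cod n (x + y)] | x y. x \<in> F n \<and> y \<in> F n}"
  "structure_of s (Aux 6) = {[cod n x, cod n y, cod n (x * y)] | x y. x \<in> F n \<and> y \<in> F n}"
  "structure_of s (Aux 7) = {[cod n x, cod n (inverse x)] | x. x \<in> F n}"
  "structure_of s (Aux 8) = {[cod n 0]}" "structure_of s (Aux 9) = {[cod n 1]}"
  "structure_of s (Aux 10) = {[x, y] | x y. x < y \<and> y < n}"
  "structure_of s (Aux 11) = {[x, Suc x] | x. Suc x < n}"
  "structure_of s (Aux 12) = Res n"
  "structure_of s (Aux 4) = {[p, q, t, a, b, cod n (W n p q t {a, b})] | p q t a b. p < n \<and> q < n \<and> t < n \<and> a < n \<and> b < n}"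
  if "n = domain_size s"
  using that by (simp_all add: structure_of_def encode_def nth_Cons')

lemma structure_of_locals:
  "structure_of s (Aux (Suc 0)) = {[p, q, t, i] | p q t i. p < n \<and> q < n \<and> t < n \<and> i \<in> basis (locals s p q t)}"
  "structure_of s (Aux 2) = {[p, q, t, i, j, cod n (ratio (locals s p q t) i j)] | p q t i j. p < n \<and> q < n \<and> t < n \<and> i < n \<and> j < n}"
  "structure_of s (Aux 3) = {[p, q, t, half (locals s p q t)] | p q t. p < n \<and> q < n \<and> t < n}"
  if "n = domain_size s"
  using that by (simp_all add: structure_of_def encode_def nth_Cons')

lemma length_aux_arities [simp]: "length (aux_arities r) = 13"
  by (simp add: aux_arities_def)

lemma definable_aux:
  assumes "set us \<subseteq> set ts" "j < 13" "length us = aux_arities r ! j"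
  shows "definable st ts (\<lambda>c. map (\<lambda>u. u c) us \<in> structure_of (st c) (Aux j))"
  using assms by (intro definable_rel) auto

lemma definable_less_var:
  assumes "t \<in> set ts" "u \<in> set ts"
  shows "definable st ts (\<lambda>c. t c < u c)"
proof (rule definable_cong)
  show "definable st ts (\<lambda>c. map (\<lambda>u. u c) [t, u] \<in> structure_of (st c) (Aux 10))"
    using assms by (intro definable_aux) (auto simp: aux_arities_def)
  show "(map (\<lambda>u. u c) [t, u] \<in> structure_of (st c) (Aux 10)) = (t c < u c)"
    if "c \<in> contexts st ts" for c
    using that assms by (auto simp: structure_of_consts[OF refl] contexts_def)
qed

lemma definable_Suc_var:
  assumes "t \<in> set ts" "u \<in> set ts"
  shows "definable st ts (\<lambda>c. u c = Suc (t c))"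
proof (rule definable_cong)
  show "definable st ts (\<lambda>c. map (\<lambda>u. u c) [t, u] \<in> structure_of (st c) (Aux 11))"
    using assms by (intro definable_aux) (auto simp: aux_arities_def)
  show "(map (\<lambda>u. u c) [t, u] \<in> structure_of (st c) (Aux 11)) = (u c = Suc (t c))"
    if "c \<in> contexts st ts" for c
    using that assms by (auto simp: structure_of_consts[OF refl] contexts_def)
qed

lemma definable_less:
  "definable_nat st ts g \<Longrightarrow> definable_nat st ts h \<Longrightarrow> definable st ts (\<lambda>c. g c < h c)"
  by (rule definable_let2[where P = "\<lambda>_ a b. a < b"]) (auto intro!: definable_less_var)

lemma definable_Suc:
  "definable_nat st ts g \<Longrightarrow> definable_nat st ts h \<Longrightarrow> definable st ts (\<lambda>c. h c = Suc (g c))"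
  by (rule definable_let2[where P = "\<lambda>_ a b. b = Suc a"]) (auto intro!: definable_Suc_var)

text \<open>\<open>LEAST\<close> unfolded into bounded quantifiers over the order, ready to become a
  formula.\<close>

lemma pick_eq_iff:
  assumes "z < n"
  shows "z = pick n Q d \<longleftrightarrow> Q z \<and> (\<forall>y<n. y < z \<longrightarrow> \<not> Q y) \<or> \<not> (\<exists>y<n. Q y) \<and> z = d"
proof (cases "\<exists>y<n. Q y")
  case True
  then have "pick n Q d = (LEAST i. i < n \<and> Q i)" by (simp add: pick_def)
  moreover have "z = (LEAST i. i < n \<and> Q i) \<longleftrightarrow> Q z \<and> (\<forall>y<n. y < z \<longrightarrow> \<not> Q y)"
  proof
    assume z: "z = (LEAST i. i < n \<and> Q i)"
    have "(LEAST i. i < n \<and> Q i) < n \<and> Q (LEAST i. i < n \<and> Q i)"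
      using True by (rule LeastI_ex)
    then show "Q z \<and> (\<forall>y<n. y < z \<longrightarrow> \<not> Q y)"
      unfolding z by (auto dest: not_less_Least)
  next
    assume "Q z \<and> (\<forall>y<n. y < z \<longrightarrow> \<not> Q y)"
    then show "z = (LEAST i. i < n \<and> Q i)"
      using assms by (intro Least_equality[symmetric]) (auto simp: not_less[symmetric])
  qed
  ultimately show ?thesis using True by auto
qed (use assms in \<open>auto simp: pick_default\<close>)

lemma definable_nat_pick:
  assumes Q: "definable (\<lambda>x. st (fst x)) (ext ts) (\<lambda>x. Q (fst x) (snd x))" and d: "definable_nat st ts d"
  shows "definable_nat st ts (\<lambda>c. pick (domain_size (st c)) (Q c) (d c))"
proof (rule definable_natI)
  show "pick (domain_size (st c)) (Q c) (d c) < domain_size (st c)" if "c \<in> contexts st ts" for c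
    using d that by (intro pick_lt) (simp add: definable_nat_def)
  let ?h = "\<lambda>x. (fst (fst x), snd x)"
  have "definable (\<lambda>x. st (fst (fst x))) (ext (ext ts)) (\<lambda>x. Q (fst (?h x)) (snd (?h x)))"
    by (rule definable_substitute[OF Q]) (auto simp: ext_def)
  then have Q': "definable (\<lambda>x. st (fst (fst x))) (ext (ext ts)) (\<lambda>x. Q (fst (fst x)) (snd x))"
    by simp
  have "definable (\<lambda>x. st (fst x)) (ext ts) (\<lambda>x. Q (fst x) (snd x) \<and>
      (\<forall>y<domain_size (st (fst x)). y < snd x \<longrightarrow> \<not> Q (fst x) y) \<or>
      \<not> (\<exists>y<domain_size (st (fst x)). Q (fst x) y) \<and> snd x = d (fst x))"
    using Q Q' d
    by (intro definable_disj definable_conj definable_all definable_not definable_ex definable_imp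
        definable_less_var) (auto simp: definable_nat_def)
  then show "definable (\<lambda>x. st (fst x)) (ext ts) (\<lambda>x. snd x = pick (domain_size (st (fst x))) (Q (fst x)) (d (fst x)))"
    by (rule definable_cong) (simp add: in_contexts_ext pick_eq_iff)
qed

section \<open>Terms with values in the field, represented by codes\<close>

definition definable_field :: "('c \<Rightarrow> 'k dyn_state) \<Rightarrow> ('c \<Rightarrow> nat) list \<Rightarrow> ('c \<Rightarrow> 'k) \<Rightarrow> bool" where
  "definable_field st ts f \<longleftrightarrow> (\<forall>c\<in>contexts st ts. f c \<in> F (domain_size (st c))) \<and>
    definable_nat st ts (\<lambda>c. cod (domain_size (st c)) (f c))"

lemma definable_fieldI:
  assumes "\<And>c. c \<in> contexts st ts \<Longrightarrow> f c \<in> F (domain_size (st c))"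
    "definable (\<lambda>x. st (fst x)) (ext ts) (\<lambda>x. snd x = cod (domain_size (st (fst x))) (f (fst x)))"
  shows "definable_field st ts f"
  unfolding definable_field_def
proof (intro conjI ballI definable_natI)
  show "cod (domain_size (st c)) (f c) < domain_size (st c)" if "c \<in> contexts st ts" for c
    using contexts_ge_2[OF that] assms(1)[OF that] by (rule cod_less)
qed (fact assms)+

lemma definable_field_fst:
  "definable_field st ts f \<Longrightarrow> definable_field (\<lambda>x. st (fst x)) (ext ts) (\<lambda>x. f (fst x))"
  using definable_nat_fst[of st ts "\<lambda>c. cod (domain_size (st c)) (f c)"]
  by (simp add: definable_field_def in_contexts_ext)

text \<open>Arithmetic is table lookup: the codes of both operands are bound by
  \<open>definable_let2\<close> and the relation \<open>Aux j\<close> is consulted. Injectivity of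
  \<open>cod\<close> makes the entry unique.\<close>

lemma definable_field_binary:
  assumes f: "definable_field st ts f" and g: "definable_field st ts g"
    and j: "j < 13" "aux_arities r ! j = 3"
    and closed: "\<And>n x y. 2 \<le> n \<Longrightarrow> x \<in> F n \<Longrightarrow> y \<in> F n \<Longrightarrow> op x y \<in> F n"
    and table: "\<And>s. structure_of s (Aux j) =
      {[cod (domain_size s) x, cod (domain_size s) y, cod (domain_size s) (op x y)] | x y.
        x \<in> F (domain_size s) \<and> y \<in> F (domain_size s)}"
  shows "definable_field st ts (\<lambda>c. op (f c) (g c))"
proof -
  let ?n = "\<lambda>c. domain_size (st c)"
  have F: "f c \<in> F (?n c)" "g c \<in> F (?n c)" "op (f c) (g c) \<in> F (?n c)" if "c \<in> contexts st ts" for c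
    using f g closed contexts_ge_2[OF that] that by (auto simp: definable_field_def)
  have "definable (\<lambda>x. st (fst x)) (ext ts) (\<lambda>x. [cod (?n (fst x)) (f (fst x)), cod (?n (fst x)) (g (fst x)), snd x]
      \<in> structure_of (st (fst x)) (Aux j))"
  proof (rule definable_let2[where P = "\<lambda>x a b. [a, b, snd x] \<in> structure_of (st (fst x)) (Aux j)"])
    show "definable (\<lambda>x. st (fst (fst (fst x)))) (ext (ext (ext ts)))
      (\<lambda>x. [snd (fst x), snd x, snd (fst (fst x))] \<in> structure_of (st (fst (fst (fst x)))) (Aux j))"
      using definable_aux[of "[\<lambda>x. snd (fst x), snd, \<lambda>x. snd (fst (fst x))]" "ext (ext (ext ts))" j
          "\<lambda>x. st (fst (fst (fst x)))"] j by simp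
  qed (use f g in \<open>auto simp: definable_field_def intro: definable_nat_fst\<close>)
  then have "definable (\<lambda>x. st (fst x)) (ext ts) (\<lambda>x. snd x = cod (?n (fst x)) (op (f (fst x)) (g (fst x))))"
  proof (rule definable_cong)
    fix x assume "x \<in> contexts (\<lambda>x. st (fst x)) (ext ts)"
    then have c: "fst x \<in> contexts st ts" by (simp add: in_contexts_ext)
    show "([cod (?n (fst x)) (f (fst x)), cod (?n (fst x)) (g (fst x)), snd x]
      \<in> structure_of (st (fst x)) (Aux j)) = (snd x = cod (?n (fst x)) (op (f (fst x)) (g (fst x))))"
      unfolding table using F[OF c] cod_eq_iff[OF contexts_ge_2[OF c]] by auto
  qed
  then show ?thesis using F by (intro definable_fieldI)
qed

lemma definable_field_add:
  "definable_field st ts f \<Longrightarrow> definable_field st ts g \<Longrightarrow> definable_field st ts (\<lambda>c. f c + g c)"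
  by (rule definable_field_binary[where j = 5]) (auto simp: aux_arities_def F_add structure_of_consts[OF refl])

lemma definable_field_mult:
  "definable_field st ts f \<Longrightarrow> definable_field st ts g \<Longrightarrow> definable_field st ts (\<lambda>c. f c * g c)"
  by (rule definable_field_binary[where j = 6]) (auto simp: aux_arities_def F_mult structure_of_consts[OF refl])

lemma definable_field_inverse:
  assumes f: "definable_field st ts f"
  shows "definable_field st ts (\<lambda>c. inverse (f c))"
proof -
  let ?n = "\<lambda>c. domain_size (st c)"
  have F: "f c \<in> F (?n c)" "inverse (f c) \<in> F (?n c)" if "c \<in> contexts st ts" for c
    using f F_inverse contexts_ge_2[OF that] that by (auto simp: definable_field_def)
  have "definable (\<lambda>x. st (fst x)) (ext ts) (\<lambda>x. [cod (?n (fst x)) (f (fst x)), snd x]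
      \<in> structure_of (st (fst x)) (Aux 7))"
  proof (rule definable_let[where P = "\<lambda>x a. [a, snd x] \<in> structure_of (st (fst x)) (Aux 7)"])
    show "definable (\<lambda>x. st (fst (fst x))) (ext (ext ts))
      (\<lambda>x. [snd x, snd (fst x)] \<in> structure_of (st (fst (fst x))) (Aux 7))"
      using definable_aux[of "[snd, \<lambda>x. snd (fst x)]" "ext (ext ts)" 7 "\<lambda>x. st (fst (fst x))"]
      by (simp add: aux_arities_def)
  qed (use f in \<open>auto simp: definable_field_def intro: definable_nat_fst\<close>)
  then have "definable (\<lambda>x. st (fst x)) (ext ts) (\<lambda>x. snd x = cod (?n (fst x)) (inverse (f (fst x))))"
  proof (rule definable_cong)
    fix x assume "x \<in> contexts (\<lambda>x. st (fst x)) (ext ts)"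
    then have c: "fst x \<in> contexts st ts" by (simp add: in_contexts_ext)
    show "([cod (?n (fst x)) (f (fst x)), snd x] \<in> structure_of (st (fst x)) (Aux 7))
      = (snd x = cod (?n (fst x)) (inverse (f (fst x))))"
      using F[OF c] cod_eq_iff[OF contexts_ge_2[OF c]] by (auto simp: structure_of_consts[OF refl])
  qed
  then show ?thesis using F by (intro definable_fieldI)
qed

lemma definable_field_divide:
  "definable_field st ts f \<Longrightarrow> definable_field st ts g \<Longrightarrow> definable_field st ts (\<lambda>c. f c / g c)"
  unfolding divide_inverse by (intro definable_field_mult definable_field_inverse)

lemma definable_field_zero: "definable_field st ts (\<lambda>c. 0)"
proof -
  have "definable (\<lambda>x. st (fst x)) (ext ts) (\<lambda>x. [snd x] \<in> structure_of (st (fst x)) (Aux 8))"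
    using definable_aux[of "[snd]" "ext ts" 8 "\<lambda>x. st (fst x)"] by (simp add: aux_arities_def)
  then show ?thesis
    by (intro definable_fieldI F_zero contexts_ge_2) (simp_all add: structure_of_consts[OF refl])
qed

lemma definable_field_one: "definable_field st ts (\<lambda>c. 1)"
proof -
  have "definable (\<lambda>x. st (fst x)) (ext ts) (\<lambda>x. [snd x] \<in> structure_of (st (fst x)) (Aux 9))"
    using definable_aux[of "[snd]" "ext ts" 9 "\<lambda>x. st (fst x)"] by (simp add: aux_arities_def)
  then show ?thesis
    by (intro definable_fieldI F_one contexts_ge_2) (simp_all add: structure_of_consts[OF refl])
qed

lemma definable_field_if:
  assumes "definable st ts P" "definable_field st ts f" "definable_field st ts g"
  shows "definable_field st ts (\<lambda>c. if P c then f c else g c)"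
proof -
  have "definable_nat st ts (\<lambda>c. if P c then cod (domain_size (st c)) (f c) else cod (domain_size (st c)) (g c))"
    using assms by (intro definable_nat_if) (simp_all add: definable_field_def)
  then show ?thesis using assms by (auto simp: definable_field_def if_distrib)
qed

lemma definable_field_eq:
  assumes "definable_field st ts f" "definable_field st ts g"
  shows "definable st ts (\<lambda>c. f c = g c)"
proof (rule definable_cong)
  show "definable st ts (\<lambda>c. cod (domain_size (st c)) (f c) = cod (domain_size (st c)) (g c))"
    using assms by (intro definable_nat_eq) (simp_all add: definable_field_def)
  show "(cod (domain_size (st c)) (f c) = cod (domain_size (st c)) (g c)) = (f c = g c)"
    if "c \<in> contexts st ts" for c
    using assms that by (intro cod_eq_iff contexts_ge_2[OF that]) (simp_all add: definable_field_def)
qed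

lemma definable_field_let:
  assumes "definable_nat st ts g" "definable_field (\<lambda>x. st (fst x)) (ext ts) (\<lambda>x. f (fst x) (snd x))"
  shows "definable_field st ts (\<lambda>c. f c (g c))"
proof -
  have "(c, g c) \<in> contexts (\<lambda>x. st (fst x)) (ext ts)" if "c \<in> contexts st ts" for c
    using assms(1) that by (simp add: in_contexts_ext definable_nat_def)
  then show ?thesis
    using assms definable_nat_let[OF assms(1), of "\<lambda>c a. cod (domain_size (st c)) (f c a)"]
    by (fastforce simp: definable_field_def)
qed

section \<open>Definability of the operations on local states\<close>

definition definable_local :: "('c \<Rightarrow> 'k dyn_state) \<Rightarrow> ('c \<Rightarrow> nat) list \<Rightarrow> ('c \<Rightarrow> 'k local_state) \<Rightarrow> bool" where
  "definable_local st ts l \<longleftrightarrow>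
    definable (\<lambda>x. st (fst x)) (ext ts) (\<lambda>x. snd x \<in> basis (l (fst x))) \<and>
    definable_field (\<lambda>x. st (fst (fst x))) (ext (ext ts)) (\<lambda>x. ratio (l (fst (fst x))) (snd (fst x)) (snd x)) \<and>
    definable_nat st ts (\<lambda>c. half (l c))"

lemma definable_local_fst:
  assumes "definable_local st ts l"
  shows "definable_local (\<lambda>x. st (fst x)) (ext ts) (\<lambda>x. l (fst x))"
proof -
  let ?h = "\<lambda>x. (fst (fst x), snd x)" and ?k = "\<lambda>x. ((fst (fst (fst x)), snd (fst x)), snd x)"
  have "definable (\<lambda>x. st (fst (fst x))) (ext (ext ts)) (\<lambda>x. snd (?h x) \<in> basis (l (fst (?h x))))"
    using assms unfolding definable_local_def
    by (elim conjE, elim definable_substitute[where h = ?h]) (auto simp: ext_def)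
  moreover have "definable_nat (\<lambda>x. st (fst (fst (fst x)))) (ext (ext (ext ts)))
      (\<lambda>x. (\<lambda>x. cod (domain_size (st (fst (fst x)))) (ratio (l (fst (fst x))) (snd (fst x)) (snd x))) (?k x))"
    using assms unfolding definable_local_def definable_field_def
    by (elim conjE, elim definable_nat_substitute[where h = ?k]) (auto simp: ext_def image_image)
  moreover have "?k x \<in> contexts (\<lambda>x. st (fst (fst x))) (ext (ext ts))"
    if "x \<in> contexts (\<lambda>x. st (fst (fst (fst x)))) (ext (ext (ext ts)))" for x
    using that by (auto simp: contexts_def ext_def)
  then have "ratio (l (fst (fst (fst x)))) (snd (fst x)) (snd x) \<in> F (domain_size (st (fst (fst (fst x)))))"
    if "x \<in> contexts (\<lambda>x. st (fst (fst (fst x)))) (ext (ext (ext ts)))" for x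
    using assms that by (fastforce simp: definable_local_def definable_field_def)
  ultimately show ?thesis
    using assms definable_nat_fst[of st ts "\<lambda>c. half (l c)"]
    by (simp add: definable_local_def definable_field_def)
qed

lemma definable_basis:
  "definable_local st ts l \<Longrightarrow> definable_nat st ts g \<Longrightarrow> definable st ts (\<lambda>c. g c \<in> basis (l c))"
  by (rule definable_let[where P = "\<lambda>c a. a \<in> basis (l c)"]) (simp_all add: definable_local_def)

lemma definable_ratio:
  assumes "definable_local st ts l" "definable_nat st ts g" "definable_nat st ts h"
  shows "definable_field st ts (\<lambda>c. ratio (l c) (g c) (h c))"
  using definable_field_let[OF assms(2), of "\<lambda>c a. ratio (l c) a (h c)"]
    definable_field_let[OF definable_nat_fst[OF assms(3)], of "\<lambda>x b. ratio (l (fst x)) (snd x) b"] assms(1)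
  by (simp add: definable_local_def)

lemma definable_half: "definable_local st ts l \<Longrightarrow> definable_nat st ts (\<lambda>c. half (l c))"
  by (simp add: definable_local_def)

lemmas definable_intros =
  definable_conj definable_disj definable_not definable_imp definable_if definable_ex definable_all
  definable_nat_if definable_field_if definable_basis definable_ratio definable_half definable_field_eq
  definable_field_add definable_field_mult definable_field_divide definable_field_zero definable_field_one
  definable_nat_eq definable_less definable_nat_pick

lemma definable_pivot:
  assumes l: "definable_local st ts l" and i: "definable_nat st ts i" and j: "definable_nat st ts j"
  shows "definable_local st ts (\<lambda>c. pivot (domain_size (st c)) (i c) (j c) (l c))"
proof -
  let ?n = "\<lambda>c. domain_size (st c)"
  note l1 = definable_local_fst[OF l] and i1 = definable_nat_fst[OF i] and j1 = definable_nat_fst[OF j]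
  note l2 = definable_local_fst[OF l1] and i2 = definable_nat_fst[OF i1] and j2 = definable_nat_fst[OF j1]
  have v1: "definable_nat (\<lambda>x. st (fst x)) (ext ts) snd" by (intro definable_nat_var) simp
  have v2: "definable_nat (\<lambda>x. st (fst (fst x))) (ext (ext ts)) (\<lambda>x. snd (fst x))"
    "definable_nat (\<lambda>x. st (fst (fst x))) (ext (ext ts)) snd" by (intro definable_nat_var; simp)+
  have "definable (\<lambda>x. st (fst x)) (ext ts) (\<lambda>x.
      if ratio (l (fst x)) (i (fst x)) (j (fst x)) = 0 then snd x \<in> basis (l (fst x))
      else (if snd x = i (fst x) then \<not> (if snd x = j (fst x) then \<not> snd x \<in> basis (l (fst x)) else snd x \<in> basis (l (fst x)))
        else (if snd x = j (fst x) then \<not> snd x \<in> basis (l (fst x)) else snd x \<in> basis (l (fst x)))))"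
    by (intro definable_intros l1 i1 j1 v1)
  then have 1: "definable (\<lambda>x. st (fst x)) (ext ts) (\<lambda>x. snd x \<in> basis (pivot (?n (fst x)) (i (fst x)) (j (fst x)) (l (fst x))))"
    by (rule definable_cong) (auto simp: pivot_def in_flip_iff)
  have "definable_field (\<lambda>x. st (fst (fst x))) (ext (ext ts)) (\<lambda>x.
      if ratio (l (fst (fst x))) (i (fst (fst x))) (j (fst (fst x))) = 0 then ratio (l (fst (fst x))) (snd (fst x)) (snd x)
      else pivot_ratio (ratio (l (fst (fst x)))) (i (fst (fst x))) (j (fst (fst x))) (snd (fst x)) (snd x))"
    unfolding pivot_ratio_def by (intro definable_intros l2 i2 j2 v2)
  then have 2: "definable_field (\<lambda>x. st (fst (fst x))) (ext (ext ts)) (\<lambda>x.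
      ratio (pivot (?n (fst (fst x))) (i (fst (fst x))) (j (fst (fst x))) (l (fst (fst x)))) (snd (fst x)) (snd x))"
    by (simp add: pivot_def if_distrib if_distribR cong: if_cong)
  \<comment> \<open>Predecessor and capped successor are choices along the successor relation. The
    default \<open>h\<close> yields \<open>0 - 1 = 0\<close> in the first case and stays at
    \<open>n - 1\<close> in the second.\<close>
  have pred: "h - 1 = pick n (\<lambda>z. h = Suc z) h" if "h < n" for h n
  proof (cases h)
    case (Suc m)
    then show ?thesis using that pick_eq_iff[of m n "\<lambda>z. h = Suc z" h] by auto
  qed (simp add: pick_default)
  have succ: "min (h + 1) (n - 1) = pick n (\<lambda>z. z = Suc h) h" if "h < n" for h n
    using that pick_eq_iff[of "Suc h" n "\<lambda>z. z = Suc h" h] pick_default[of n "\<lambda>z. z = Suc h" h]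
    by (cases "Suc h < n") auto
  have h1: "definable_nat (\<lambda>x. st (fst x)) (ext ts) (\<lambda>x. half (l (fst x)))"
    by (intro definable_half l1)
  have "definable_nat st ts (\<lambda>c. if ratio (l c) (i c) (j c) = 0 then half (l c)
      else if i c \<in> basis (l c) \<and> j c \<in> basis (l c) then pick (?n c) (\<lambda>z. half (l c) = Suc z) (half (l c))
      else if i c \<in> basis (l c) \<or> j c \<in> basis (l c) then half (l c)
      else pick (?n c) (\<lambda>z. z = Suc (half (l c))) (half (l c)))"
    by (intro definable_intros definable_Suc l i j h1 v1)
  then have 3: "definable_nat st ts (\<lambda>c. half (pivot (?n c) (i c) (j c) (l c)))"
  proof (rule definable_nat_cong)
    fix c assume "c \<in> contexts st ts"
    then have "half (l c) < ?n c" using definable_half[OF l] by (simp add: definable_nat_def)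
    then show "(if ratio (l c) (i c) (j c) = 0 then half (l c)
      else if i c \<in> basis (l c) \<and> j c \<in> basis (l c) then pick (?n c) (\<lambda>z. half (l c) = Suc z) (half (l c))
      else if i c \<in> basis (l c) \<or> j c \<in> basis (l c) then half (l c)
      else pick (?n c) (\<lambda>z. z = Suc (half (l c))) (half (l c))) = half (pivot (?n c) (i c) (j c) (l c))"
      unfolding pred[OF \<open>half (l c) < ?n c\<close>, symmetric] succ[OF \<open>half (l c) < ?n c\<close>, symmetric]
      by (simp add: pivot_def pivot_half_def)
  qed
  show ?thesis using 1 2 3 by (simp add: definable_local_def)
qed

lemma definable_remove:
  assumes l: "definable_local st ts l" and a: "definable_nat st ts a"
  shows "definable_local st ts (\<lambda>c. remove (domain_size (st c)) (a c) (l c))"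
  unfolding remove_def
  by (intro definable_pivot definable_intros l a definable_local_fst[OF l] definable_nat_fst[OF a] definable_nat_var)
    simp_all

lemma definable_augment:
  assumes l: "definable_local st ts l"
  shows "definable_local st ts (\<lambda>c. augment (domain_size (st c)) (l c))"
proof -
  note l1 = definable_local_fst[OF l] 
  note l2 = definable_local_fst[OF l1]
  have v1: "definable_nat (\<lambda>x. st (fst x)) (ext ts) snd" by (intro definable_nat_var) simp
  have v2: "definable_nat (\<lambda>x. st (fst (fst x))) (ext (ext ts)) (\<lambda>x. snd (fst x))"
    "definable_nat (\<lambda>x. st (fst (fst x))) (ext (ext ts)) snd" by (intro definable_nat_var; simp)+
  \<comment> \<open>The element \<open>0\<close> is named as the least one satisfying a trivial
    condition; \<open>half\<close> merely supplies a default.\<close>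
  have zero: "definable_nat st ts (\<lambda>c. 0)"
  proof (rule definable_nat_cong)
    have "definable_nat st ts (\<lambda>c. pick (domain_size (st c)) (\<lambda>z. z = z) (half (l c)))"
      by (intro definable_intros l v1)
    then show "definable_nat st ts (\<lambda>c. pick (domain_size (st c)) (\<lambda>z. z = z) (half (l c)))" .
    show "pick (domain_size (st c)) (\<lambda>z. z = z) (half (l c)) = 0" if "c \<in> contexts st ts" for c
      using pick_eq_iff[of 0 "domain_size (st c)" "\<lambda>z. z = z"] contexts_ge_2[OF that] by auto
  qed
  have row: "definable_nat st ts (\<lambda>c. free_row (domain_size (st c)) (l c))"
    unfolding free_row_def by (intro definable_intros zero l1 l2 v1 v2)
  note row1 = definable_nat_fst[OF row]
  show ?thesis
    unfolding augment_def free_column_def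
    by (intro definable_pivot definable_nat_pick row definable_intros l l1 row1 v1)
qed

lemma definable_add_edge:
  assumes l: "definable_local st ts l" and a: "definable_nat st ts a" and b: "definable_nat st ts b"
    and d: "definable_field st ts d"
  shows "definable_local st ts (\<lambda>c. add_edge (a c) (b c) (d c) (l c))"
proof -
  have v2: "definable_nat (\<lambda>x. st (fst (fst x))) (ext (ext ts)) (\<lambda>x. snd (fst x))"
    "definable_nat (\<lambda>x. st (fst (fst x))) (ext (ext ts)) snd" by (intro definable_nat_var; simp)+
  have "definable_field (\<lambda>x. st (fst (fst x))) (ext (ext ts)) (\<lambda>x.
      ratio (l (fst (fst x))) (snd (fst x)) (snd x) +
      (if snd (fst x) = a (fst (fst x)) \<and> snd x = b (fst (fst x)) \<or> snd (fst x) = b (fst (fst x)) \<and> snd x = a (fst (fst x))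
       then d (fst (fst x)) else 0))"
    by (intro definable_intros v2 definable_local_fst[OF definable_local_fst[OF l]]
      definable_nat_fst[OF definable_nat_fst[OF a]] definable_nat_fst[OF definable_nat_fst[OF b]]
      definable_field_fst[OF definable_field_fst[OF d]])
  then show ?thesis using l by (simp add: definable_local_def add_edge_def)
qed

lemma definable_update:
  assumes "definable_local st ts l" "definable_nat st ts a" "definable_nat st ts b" "definable_field st ts d"
  shows "definable_local st ts (\<lambda>c. update (domain_size (st c)) (a c) (b c) (d c) (l c))"
  unfolding update_def
  by (intro definable_augment definable_add_edge definable_remove assms)

end

section \<open>The dynamic program\<close>

text \<open>Decides whether the undirected edge really appears or disappears: a loop, the presence
  of the reverse tuple, or a tuple already in the requested state leaves the edge set as it is.
  Appearing and disappearing need no distinction, since both add the weight.\<close>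

definition toggles :: "kind \<Rightarrow> relations \<Rightarrow> nat \<Rightarrow> nat \<Rightarrow> bool" where
  "toggles \<kappa> I a b \<longleftrightarrow> a \<noteq> b \<and> [b, a] \<notin> I 0 \<and> ([a, b] \<in> I 0 \<longleftrightarrow> \<kappa> = Delete)"

lemma restrict_weight_change:
  "restrict_weight (edges (apply_change (\<kappa>, 0, [a, b]) I)) x =
    (restrict_weight (edges I) x)({a, b} := restrict_weight (edges I) x {a, b} + (if toggles \<kappa> I a b then x {a, b} else 0))"
proof -
  have edge: "{c, d} \<in> edges J \<longleftrightarrow> c \<noteq> d \<and> ([c, d] \<in> J 0 \<or> [d, c] \<in> J 0)" for c d J
    by (auto simp: edges_def doubleton_eq_iff)
  have other: "e \<in> edges (apply_change (\<kappa>, 0, [a, b]) I) \<longleftrightarrow> e \<in> edges I" if "e \<noteq> {a, b}" for e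
    using that by (cases \<kappa>) (auto simp: edges_def)
  have same: "{a, b} \<in> edges (apply_change (\<kappa>, 0, [a, b]) I) \<longleftrightarrow> ({a, b} \<in> edges I) \<noteq> toggles \<kappa> I a b"
    by (cases \<kappa>) (auto simp: edge toggles_def)
  show ?thesis
    by (rule ext) (simp add: restrict_weight_def other same add_self)
qed

lemma edges_subset: "I 0 \<subseteq> tuples n 2 \<Longrightarrow> edges I \<subseteq> all_pairs n"
proof
  fix e assume "I 0 \<subseteq> tuples n 2" "e \<in> edges I"
  then obtain c d where "e = {c, d}" "c \<noteq> d" "[c, d] \<in> tuples n 2"
    by (auto simp: edges_def)
  then show "e \<in> all_pairs n" by (simp add: all_pairs_def tuples_def)
qed

lemma apply_change_tuples:
  "I 0 \<subseteq> tuples n 2 \<Longrightarrow> valid_change n graph_schema c \<Longrightarrow> apply_change c I 0 \<subseteq> tuples n 2"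
  by (cases c; cases "fst c") (auto simp: valid_change_def graph_schema_def)

lemma matching_card_le:
  assumes "E \<subseteq> all_pairs n" "matching E M"
  shows "\<Union>M \<subseteq> {..<n}" "card (\<Union>M) = 2 * card M" "2 * card M \<le> n"
proof -
  show sub: "\<Union>M \<subseteq> {..<n}" using assms by (auto simp: matching_def all_pairs_def)
  show eq: "card (\<Union>M) = 2 * card M"
    using finite_subset[OF sub] by (intro card_pairing matching_pairings[OF assms]) simp
  show "2 * card M \<le> n"
    using card_mono[OF _ sub] eq by simp
qed

lemma matching_number_le:
  assumes "E \<subseteq> all_pairs n"
  shows "2 * matching_number E \<le> n"
proof -
  have "finite E" using assms finite_all_pairs finite_subset by blast
  then obtain M where "matching E M" "card M = matching_number E" by (rule maximum_matching)
  then show ?thesis using matching_card_le(3)[OF assms] by metis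
qed

lemma matching_number_empty: "matching_number {} = 0"
  using matching_number_le[of "{}" 0] by simp

definition lone :: fo where
  "lone = Uni 0 (Uni 1 (Eq 0 1))"

lemma sat_lone: "1 \<le> n \<Longrightarrow> sat n S v lone \<longleftrightarrow> n = 1"
proof -
  assume n: "1 \<le> n"
  have "sat n S v lone \<longleftrightarrow> (\<forall>a<n. \<forall>b<n. a = b)" by (simp add: lone_def)
  also have "\<dots> \<longleftrightarrow> n = 1"
  proof
    assume "\<forall>a<n. \<forall>b<n. a = b"
    then have "\<not> 1 < n" by (metis less_trans zero_less_one zero_neq_one)
    then show "n = 1" using n by simp
  qed simp
  finally show ?thesis .
qed

section \<open>Update formulas for the auxiliary relations\<close>

context matching_fo
begin

definition next_local :: "kind \<Rightarrow> 'k dyn_state \<Rightarrow> nat \<Rightarrow> nat \<Rightarrow> nat \<Rightarrow> nat \<Rightarrow> nat \<Rightarrow> 'k local_state" where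
  "next_local \<kappa> s a b p q t = update (domain_size s) a b
    (if toggles \<kappa> (input_rels s) a b then W (domain_size s) p q t {a, b} else 0) (locals s p q t)"

definition is_max_half :: "nat \<Rightarrow> (nat \<Rightarrow> nat \<Rightarrow> nat \<Rightarrow> 'k local_state) \<Rightarrow> nat \<Rightarrow> bool" where
  "is_max_half n L m \<longleftrightarrow>
    (\<exists>p<n. \<exists>q<n. \<exists>t<n. m = half (L p q t)) \<and> (\<forall>p<n. \<forall>q<n. \<forall>t<n. \<not> m < half (L p q t))"

text \<open>Update formulas are evaluated before the change, so the new local states cannot be read
  from relations here; their definitions are substituted into the formula for the answer.\<close>

definition next_answer :: "kind \<Rightarrow> 'k dyn_state \<Rightarrow> nat \<Rightarrow> nat \<Rightarrow> nat list set" where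
  "next_answer \<kappa> s a b =
    {bs. \<exists>m<domain_size s. is_max_half (domain_size s) (next_local \<kappa> s a b) m \<and> m # bs \<in> Res (domain_size s)}"

lemma Res_tail: "{bs. m # bs \<in> Res n} \<subseteq> tuples n r"
proof
  fix bs assume "bs \<in> {bs. m # bs \<in> Res n}"
  then have "m # bs \<in> tuples n (Suc r)" using Res_tuples by auto
  then show "bs \<in> tuples n r" by (simp add: tuples_def)
qed

lemma definable_locals:
  assumes "p \<in> set ts" "q \<in> set ts" "t \<in> set ts"
  shows "definable_local st ts (\<lambda>c. locals (st c) (p c) (q c) (t c))"
proof -
  have good: "good_local (domain_size (st c)) (locals (st c) (p c) (q c) (t c))"
    and lt: "p c < domain_size (st c)" "q c < domain_size (st c)" "t c < domain_size (st c)"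
    if "c \<in> contexts st ts" for c
    using that assms unfolding contexts_def mem_Collect_eq by (auto simp: good_states_def)
  have "definable (\<lambda>x. st (fst x)) (ext ts)
    (\<lambda>x. map (\<lambda>u. u x) [\<lambda>x. p (fst x), \<lambda>x. q (fst x), \<lambda>x. t (fst x), snd] \<in> structure_of (st (fst x)) (Aux 1))"
    using assms by (intro definable_aux) (auto simp: aux_arities_def)
  then have 1: "definable (\<lambda>x. st (fst x)) (ext ts)
    (\<lambda>x. snd x \<in> basis (locals (st (fst x)) (p (fst x)) (q (fst x)) (t (fst x))))"
    by (rule definable_cong) (simp add: structure_of_locals[OF refl] in_contexts_ext lt)
  have "definable (\<lambda>x. st (fst (fst (fst x)))) (ext (ext (ext ts)))
    (\<lambda>x. map (\<lambda>u. u x) [\<lambda>x. p (fst (fst (fst x))), \<lambda>x. q (fst (fst (fst x))), \<lambda>x. t (fst (fst (fst x))),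
      \<lambda>x. snd (fst (fst x)), \<lambda>x. snd (fst x), snd] \<in> structure_of (st (fst (fst (fst x)))) (Aux 2))"
    using assms by (intro definable_aux) (auto simp: aux_arities_def intro!: ext_old)
  then have "definable (\<lambda>x. st (fst (fst (fst x)))) (ext (ext (ext ts)))
    (\<lambda>x. snd x = cod (domain_size (st (fst (fst (fst x)))))
      (ratio (locals (st (fst (fst (fst x)))) (p (fst (fst (fst x)))) (q (fst (fst (fst x)))) (t (fst (fst (fst x)))))
        (snd (fst (fst x))) (snd (fst x))))"
    by (rule definable_cong) (simp add: structure_of_locals[OF refl] in_contexts_ext3 lt)
  then have 2: "definable_field (\<lambda>x. st (fst (fst x))) (ext (ext ts))
    (\<lambda>x. ratio (locals (st (fst (fst x))) (p (fst (fst x))) (q (fst (fst x))) (t (fst (fst x)))) (snd (fst x)) (snd x))"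
    by (intro definable_fieldI) (use good in \<open>auto simp: in_contexts_ext2 good_local_def\<close>)
  have "definable (\<lambda>x. st (fst x)) (ext ts)
    (\<lambda>x. map (\<lambda>u. u x) [\<lambda>x. p (fst x), \<lambda>x. q (fst x), \<lambda>x. t (fst x), snd] \<in> structure_of (st (fst x)) (Aux 3))"
    using assms by (intro definable_aux) (auto simp: aux_arities_def)
  then have "definable (\<lambda>x. st (fst x)) (ext ts)
    (\<lambda>x. snd x = half (locals (st (fst x)) (p (fst x)) (q (fst x)) (t (fst x))))"
    by (rule definable_cong) (simp add: structure_of_locals[OF refl] in_contexts_ext lt)
  then have "definable_nat st ts (\<lambda>c. half (locals (st c) (p c) (q c) (t c)))"
    by (intro definable_natI) (use good in \<open>auto simp: good_local_def\<close>)
  with 1 2 show ?thesis by (simp add: definable_local_def)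
qed

lemma definable_weight:
  assumes "p \<in> set ts" "q \<in> set ts" "t \<in> set ts" "a \<in> set ts" "b \<in> set ts"
  shows "definable_field st ts (\<lambda>c. W (domain_size (st c)) (p c) (q c) (t c) {a c, b c})"
proof (rule definable_fieldI)
  have lt: "u c < domain_size (st c)" if "c \<in> contexts st ts" "u \<in> set ts" for c u
    using that by (simp add: contexts_def)
  have "definable (\<lambda>x. st (fst x)) (ext ts)
    (\<lambda>x. map (\<lambda>u. u x) [\<lambda>x. p (fst x), \<lambda>x. q (fst x), \<lambda>x. t (fst x), \<lambda>x. a (fst x), \<lambda>x. b (fst x), snd]
      \<in> structure_of (st (fst x)) (Aux 4))"
    using assms by (intro definable_aux) (auto simp: aux_arities_def)
  then show "definable (\<lambda>x. st (fst x)) (ext ts)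
    (\<lambda>x. snd x = cod (domain_size (st (fst x)))
      (W (domain_size (st (fst x))) (p (fst x)) (q (fst x)) (t (fst x)) {a (fst x), b (fst x)}))"
    by (rule definable_cong) (simp add: structure_of_consts[OF refl] in_contexts_ext lt assms)
qed (intro W_in_F contexts_ge_2)

lemma definable_toggles:
  assumes "a \<in> set ts" "b \<in> set ts"
  shows "definable st ts (\<lambda>c. toggles \<kappa> (input_rels (st c)) (a c) (b c))"
proof -
  have edge: "definable st ts (\<lambda>c. [u c, v c] \<in> input_rels (st c) 0)" if "u \<in> set ts" "v \<in> set ts" for u v
    using definable_rel[of "[u, v]" ts "Inp 0" st] that by (simp add: graph_schema_def structure_of_def)
  have "definable st ts (\<lambda>c. \<not> a c = b c \<and> \<not> [b c, a c] \<in> input_rels (st c) 0 \<and>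
      (if \<kappa> = Delete then [a c, b c] \<in> input_rels (st c) 0 else \<not> [a c, b c] \<in> input_rels (st c) 0))"
    by (cases \<kappa>) (simp_all, (intro definable_conj definable_not definable_eq edge assms)+)
  then show ?thesis
    by (rule definable_cong) (auto simp: toggles_def)
qed

lemma definable_next_local:
  assumes "a \<in> set ts" "b \<in> set ts" "p \<in> set ts" "q \<in> set ts" "t \<in> set ts"
  shows "definable_local st ts (\<lambda>c. next_local \<kappa> (st c) (a c) (b c) (p c) (q c) (t c))"
  unfolding next_local_def
  by (intro definable_update definable_locals definable_nat_var definable_field_if definable_toggles
      definable_weight definable_field_zero assms)

lemma definable_is_max_half:
  assumes "a \<in> set ts" "b \<in> set ts" "m \<in> set ts"
  shows "definable st ts (\<lambda>c. is_max_half (domain_size (st c)) (next_local \<kappa> (st c) (a c) (b c)) (m c))"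
proof -
  have v: "(\<lambda>x. u (fst (fst (fst x)))) \<in> set (ext (ext (ext ts)))" if "u \<in> set ts" for u
    using ext_old[OF ext_old[OF ext_old[OF that]]] .
  have half: "definable_nat (\<lambda>x. st (fst (fst (fst x)))) (ext (ext (ext ts)))
    (\<lambda>x. half (next_local \<kappa> (st (fst (fst (fst x)))) (a (fst (fst (fst x)))) (b (fst (fst (fst x))))
      (snd (fst (fst x))) (snd (fst x)) (snd x)))"
    using assms v by (intro definable_half definable_next_local) simp_all
  have m: "definable_nat (\<lambda>x. st (fst (fst (fst x)))) (ext (ext (ext ts))) (\<lambda>x. m (fst (fst (fst x))))"
    using assms v by (intro definable_nat_var) simp
  show ?thesis
    unfolding is_max_half_def
    by (intro definable_conj definable_ex definable_all definable_not definable_nat_eq definable_less half m)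
qed

definition vars :: "nat \<Rightarrow> ('k dyn_state \<times> nat list \<Rightarrow> nat) list" where
  "vars m = map (\<lambda>i c. snd c ! i) [0..<m]"

lemma in_vars: "i < m \<Longrightarrow> (\<lambda>c. snd c ! i) \<in> set (vars m)"
  by (auto simp: vars_def)

lemma definable_formula:
  assumes "definable fst (vars m) P"
  shows "\<exists>\<phi>. wf_fo graph_schema (aux_arities r) \<phi> \<and> fv \<phi> \<subseteq> {..<m} \<and>
    (\<forall>s\<in>good_states. \<forall>xs\<in>tuples (domain_size s) m.
      sat (domain_size s) (structure_of s) ((!) xs) \<phi> = P (s, xs))"
proof -
  have length_vars: "length (vars m) = m" by (simp add: vars_def)
  obtain \<phi> where \<phi>: "wf_fo graph_schema (aux_arities r) \<phi>" "fv \<phi> \<subseteq> {..<m}"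
    "\<And>c v. c \<in> contexts fst (vars m) \<Longrightarrow> (\<forall>i<m. v i = (vars m ! i) c) \<Longrightarrow>
      sat (domain_size (fst c)) (structure_of (fst c)) v \<phi> = P c"
    using assms unfolding definable_def length_vars by blast
  have "sat (domain_size s) (structure_of s) ((!) xs) \<phi> = P (s, xs)"
    if s: "s \<in> good_states" and xs: "xs \<in> tuples (domain_size s) m" for s xs
  proof -
    have "xs ! i < domain_size s" if "i < m" for i
    proof -
      have "xs ! i \<in> set xs" "set xs \<subseteq> {..<domain_size s}"
        using xs that by (simp_all add: tuples_def)
      then show ?thesis by blast
    qed
    then have "(s, xs) \<in> contexts fst (vars m)"
      using s unfolding contexts_def by (auto simp: vars_def)
    then show ?thesis using \<phi>(3)[of "(s, xs)" "(!) xs"] by (simp add: vars_def)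
  qed
  with \<phi>(1,2) show ?thesis by (intro exI[of _ \<phi>] conjI ballI)
qed

lemma update_formula:
  assumes "j < 4"
  shows "\<exists>\<phi>. wf_fo graph_schema (aux_arities r) \<phi> \<and> fv \<phi> \<subseteq> {..<2 + aux_arities r ! j} \<and>
    (\<forall>s\<in>good_states. \<forall>a<domain_size s. \<forall>b<domain_size s. \<forall>bs\<in>tuples (domain_size s) (aux_arities r ! j).
      sat (domain_size s) (structure_of s) ((!) ([a, b] @ bs)) \<phi> =
      (bs \<in> encode (domain_size s) (next_answer \<kappa> s a b) (next_local \<kappa> s a b) j))"
proof -
  let ?v = "\<lambda>i (c :: 'k dyn_state \<times> nat list). snd c ! i" and ?m = "2 + aux_arities r ! j"
  \<comment> \<open>For the relations of local states, positions 0 and 1 hold the changed pair, 2 to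
    4 the triple of the assignment, and the later ones the remaining entries of the target
    tuple.\<close>
  let ?l = "\<lambda>c. next_local \<kappa> (fst c) (?v 0 c) (?v 1 c) (?v 2 c) (?v 3 c) (?v 4 c)"
  have "\<exists>P. definable fst (vars ?m) P \<and>
    (\<forall>s\<in>good_states. \<forall>a<domain_size s. \<forall>b<domain_size s. \<forall>bs\<in>tuples (domain_size s) (aux_arities r ! j).
      P (s, [a, b] @ bs) = (bs \<in> encode (domain_size s) (next_answer \<kappa> s a b) (next_local \<kappa> s a b) j))"
  proof -
    consider "j = 0" | "j = 1" | "j = 2" | "j = 3" using assms by linarith
    then show ?thesis
    proof cases
      case 1
      \<comment> \<open>The new maximum followed by the target tuple, whose entries start at
        position 2, is looked up in \<open>Res\<close>.\<close>
      let ?us = "snd # map (\<lambda>i x. snd (fst x) ! (i + 2)) [0..<r]"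
      have "definable fst (vars (2 + r)) (\<lambda>c. \<exists>m<domain_size (fst c).
          is_max_half (domain_size (fst c)) (next_local \<kappa> (fst c) (?v 0 c) (?v 1 c)) m \<and>
          map (\<lambda>u. u (c, m)) ?us \<in> structure_of (fst c) (Aux 12))"
      proof (intro definable_ex definable_conj)
        show "definable (\<lambda>x. fst (fst x)) (ext (vars (2 + r)))
          (\<lambda>x. is_max_half (domain_size (fst (fst x))) (next_local \<kappa> (fst (fst x)) (?v 0 (fst x)) (?v 1 (fst x))) (snd x))"
          by (intro definable_is_max_half ext_old in_vars ext_new) simp_all
        have "set ?us \<subseteq> set (ext (vars (2 + r)))"
          by (auto intro!: ext_old[of "\<lambda>c. snd c ! i" for i] in_vars)
        then have "definable (\<lambda>x. fst (fst x)) (ext (vars (2 + r))) (\<lambda>x. map (\<lambda>u. u x) ?us \<in> structure_of (fst (fst x)) (Aux 12))"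
          by (intro definable_aux) (auto simp: aux_arities_def)
        then show "definable (\<lambda>x. fst (fst x)) (ext (vars (2 + r)))
          (\<lambda>x. map (\<lambda>u. u (fst x, snd x)) ?us \<in> structure_of (fst (fst x)) (Aux 12))" by simp
      qed
      moreover have "map (\<lambda>i. bs ! i) [0..<r] = bs" if "bs \<in> tuples n r" for bs n
        using that map_nth[of bs] by (simp add: tuples_def)
      ultimately show ?thesis
        using 1 by (intro exI conjI) (auto simp: aux_arities_def encode_def next_answer_def structure_of_consts[OF refl] comp_def)
    next
      case 2
      have "definable fst (vars 6) (\<lambda>c. ?v 5 c \<in> basis (?l c))"
        by (intro definable_basis definable_next_local definable_nat_var in_vars) simp_all
      then show ?thesis
        using 2 by (intro exI conjI) (auto simp: aux_arities_def encode_def tuples_def length_Suc_conv numeral_eq_Suc)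
    next
      case 3
      have "definable_field fst (vars 8) (\<lambda>c. ratio (?l c) (?v 5 c) (?v 6 c))"
        by (intro definable_ratio definable_next_local definable_nat_var in_vars) simp_all
      then have "definable fst (vars 8) (\<lambda>c. ?v 7 c = cod (domain_size (fst c)) (ratio (?l c) (?v 5 c) (?v 6 c)))"
        by (intro definable_nat_eq[OF definable_nat_var[OF in_vars]]) (simp_all add: definable_field_def)
      then show ?thesis
        using 3 by (intro exI conjI) (auto simp: aux_arities_def encode_def tuples_def length_Suc_conv numeral_eq_Suc)
    next
      case 4
      have "definable fst (vars 6) (\<lambda>c. ?v 5 c = half (?l c))"
        by (intro definable_nat_eq definable_half definable_next_local definable_nat_var in_vars) simp_all
      then show ?thesis
        using 4 by (intro exI conjI) (auto simp: aux_arities_def encode_def tuples_def length_Suc_conv numeral_eq_Suc)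
    qed
  qed
  then obtain P where P: "definable fst (vars ?m) P" and
    eq: "\<And>s a b bs. s \<in> good_states \<Longrightarrow> a < domain_size s \<Longrightarrow> b < domain_size s \<Longrightarrow>
      bs \<in> tuples (domain_size s) (aux_arities r ! j) \<Longrightarrow>
      P (s, [a, b] @ bs) = (bs \<in> encode (domain_size s) (next_answer \<kappa> s a b) (next_local \<kappa> s a b) j)"
    by metis
  obtain \<phi> where \<phi>: "wf_fo graph_schema (aux_arities r) \<phi>" "fv \<phi> \<subseteq> {..<?m}"
    "\<And>s xs. s \<in> good_states \<Longrightarrow> xs \<in> tuples (domain_size s) ?m \<Longrightarrow>
      sat (domain_size s) (structure_of s) ((!) xs) \<phi> = P (s, xs)"
    using definable_formula[OF P] by metis
  have "[a, b] @ bs \<in> tuples n ?m" if "a < n" "b < n" "bs \<in> tuples n (aux_arities r ! j)" for a b n bs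
    using that by (auto simp: tuples_def)
  then show ?thesis using \<phi> eq by (intro exI[of _ \<phi>] conjI ballI allI impI) simp_all
qed

definition update_phi :: "kind \<Rightarrow> nat \<Rightarrow> fo" where
  "update_phi \<kappa> j = (SOME \<phi>. wf_fo graph_schema (aux_arities r) \<phi> \<and> fv \<phi> \<subseteq> {..<2 + aux_arities r ! j} \<and>
    (\<forall>s\<in>good_states. \<forall>a<domain_size s. \<forall>b<domain_size s. \<forall>bs\<in>tuples (domain_size s) (aux_arities r ! j).
      sat (domain_size s) (structure_of s) ((!) ([a, b] @ bs)) \<phi> =
      (bs \<in> encode (domain_size s) (next_answer \<kappa> s a b) (next_local \<kappa> s a b) j)))"

lemma update_phi:
  assumes "j < 4"
  shows "wf_fo graph_schema (aux_arities r) (update_phi \<kappa> j)" "fv (update_phi \<kappa> j) \<subseteq> {..<2 + aux_arities r ! j}"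
    "s \<in> good_states \<Longrightarrow> a < domain_size s \<Longrightarrow> b < domain_size s \<Longrightarrow>
      bs \<in> tuples (domain_size s) (aux_arities r ! j) \<Longrightarrow>
      sat (domain_size s) (structure_of s) ((!) (a # b # bs)) (update_phi \<kappa> j) \<longleftrightarrow>
      bs \<in> encode (domain_size s) (next_answer \<kappa> s a b) (next_local \<kappa> s a b) j"
  using someI_ex[OF update_formula[OF assms, of \<kappa>], folded update_phi_def] by auto

section \<open>The program and a single step of it\<close>

definition keep :: "nat \<Rightarrow> fo" where
  "keep j = Rel (Aux j) (map (\<lambda>i. i + 2) [0..<aux_arities r ! j])"

text \<open>On the one-element domain the answer never changes, and the other relations are junk there.\<close>

definition program :: dyn_program where
  "program = \<lparr>aux_schema = aux_arities r,
    update_fo = \<lambda>\<kappa> i j.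
      if j = 0 then Disj (Conj lone (keep 0)) (Conj (Neg lone) (update_phi \<kappa> 0))
      else if j < 4 then update_phi \<kappa> j else keep j,
    designated = 0\<rparr>"

lemma sat_keep:
  assumes "length bs = aux_arities r ! j"
  shows "sat n (interp I A) ((!) (a # b # bs)) (keep j) \<longleftrightarrow> bs \<in> A j"
proof -
  have "map ((!) (a # b # bs)) (map (\<lambda>i. i + 2) [0..<aux_arities r ! j]) = bs"
    using map_nth[of bs] assms by (simp add: comp_def)
  then show ?thesis by (simp add: keep_def)
qed

lemma wf_program: "wf_program graph_schema program"
proof -
  have "wf_fo graph_schema (aux_arities r) (keep j)" "fv (keep j) \<subseteq> {..<2 + aux_arities r ! j}" if "j < 13" for j
    using that by (auto simp: keep_def)
  moreover have "wf_fo graph_schema (aux_arities r) lone" "fv lone = {}"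
    by (auto simp: lone_def)
  ultimately show ?thesis
    using update_phi(1,2) by (auto simp: wf_program_def program_def graph_schema_def)
qed

lemma encode_tuples:
  assumes "2 \<le> n" "A \<subseteq> tuples n r" "\<And>p q t. good_local n (L p q t)" "j < 13"
  shows "encode n A L j \<subseteq> tuples n (aux_arities r ! j)"
proof -
  note F = cod_less[OF assms(1)] F_zero[OF assms(1)] F_one[OF assms(1)] F_add[OF assms(1)]
    F_mult[OF assms(1)] F_inverse[OF assms(1)] W_in_F[OF assms(1)]
  have L: "i \<in> basis (L p q t) \<Longrightarrow> i < n" "ratio (L p q t) i k \<in> F n" "half (L p q t) < n" for p q t i k
    using assms(3)[of p q t] by (auto simp: good_local_def)
  have "j = 0 \<or> j = 1 \<or> j = 2 \<or> j = 3 \<or> j = 4 \<or> j = 5 \<or> j = 6 \<or> j = 7 \<or> j = 8 \<or> j = 9 \<or>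
      j = 10 \<or> j = 11 \<or> j = 12"
    using assms(4) by presburger
  then show ?thesis
    using assms(2) Res_tuples[of n]
    by (elim disjE; simp add: encode_def aux_arities_def tuples_def)
      (use F L in auto)
qed

lemma encode_constant: "4 \<le> j \<Longrightarrow> encode n A L j = encode n A' L' j"
  by (auto simp: encode_def nth_Cons' numeral_eq_Suc)

lemma step_program:
  assumes n: "2 \<le> n" and L: "\<And>p q t. good_local n (L p q t)" and ab: "a < n" "b < n"
    and s: "s = \<lparr>domain_size = n, input_rels = I, answer_rel = A, locals = L\<rparr>"
    and A: "A \<subseteq> tuples n r" and L': "\<And>p q t. good_local n (next_local \<kappa> s a b p q t)"
  shows "step n program (\<kappa>, 0, [a, b]) (I, encode n A L)
    = (apply_change (\<kappa>, 0, [a, b]) I, encode n (next_answer \<kappa> s a b) (next_local \<kappa> s a b))"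
proof -
  let ?e = "encode n (next_answer \<kappa> s a b) (next_local \<kappa> s a b)"
  have good: "s \<in> good_states" using n L by (simp add: s good_states_def)
  have str: "interp I (encode n A L) = structure_of s" by (simp add: structure_of_def s)
  have dom: "domain_size s = n" by (simp add: s)
  have "next_answer \<kappa> s a b \<subseteq> tuples n r"
    using Res_tail[of _ n] by (auto simp: next_answer_def dom)
  then have sub: "?e j \<subseteq> tuples n (aux_arities r ! j)" if "j < 13" for j
    using that by (intro encode_tuples n L')
  have not_lone: "\<not> sat n S v lone" for S v using n by (simp add: sat_lone)
  have "(if j < 13 then {bs \<in> tuples n (aux_arities r ! j).
      sat n (interp I (encode n A L)) ((!) ([a, b] @ bs)) (update_fo program \<kappa> 0 j)} else {}) = ?e j" for j
  proof (cases "j < 13")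
    case j: True
    have "sat n (interp I (encode n A L)) ((!) ([a, b] @ bs)) (update_fo program \<kappa> 0 j) \<longleftrightarrow> bs \<in> ?e j"
      if "bs \<in> tuples n (aux_arities r ! j)" for bs
    proof (cases "j < 4")
      case True
      then show ?thesis
        using update_phi(3)[OF True good, of a b bs \<kappa>] ab that not_lone by (auto simp: program_def str dom)
    next
      case False
      have "length bs = aux_arities r ! j" using that by (simp add: tuples_def)
      then show ?thesis
        using False encode_constant[of j n A L "next_answer \<kappa> s a b" "next_local \<kappa> s a b"]
        by (simp add: program_def sat_keep)
    qed
    then show ?thesis using sub[OF j] j by auto
  qed (simp add: encode_def)
  then show ?thesis by (simp add: program_def cong: if_cong)
qed

text \<open>A Pfaffian is a polynomial in the weights; hence the ratios of a valid state stay in the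
  field and have codes.\<close>

lemma pf_in_F:
  fixes w :: "'a set \<Rightarrow> 'k"
  assumes "2 \<le> n" "\<And>e. w e \<in> F n"
  shows "pf w S \<in> F n"
proof -
  have "(\<Prod>e\<in>M. w e) \<in> F n" for M
    using assms by (induction M rule: infinite_finite_induct) (auto intro: F_one F_mult)
  moreover have "(\<Sum>M\<in>N. f M) \<in> F n" if "\<And>M. f M \<in> F n" for N and f :: "'a set set \<Rightarrow> 'k"
    using assms that by (induction N rule: infinite_finite_induct) (auto intro: F_zero F_add)
  ultimately show ?thesis by (simp add: pf_def)
qed

lemma optimal_good:
  assumes n: "2 \<le> n" and opt: "optimal n (restrict_weight E (W n p q t)) l"
  shows "good_local n l"
proof -
  have F: "pf (restrict_weight E (W n p q t)) S \<in> F n" for S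
    using n F_zero W_in_F by (intro pf_in_F) (auto simp: restrict_weight_def)
  have v: "valid n (restrict_weight E (W n p q t)) l" using opt by (simp add: optimal_def)
  then have sub: "basis l \<subseteq> {..<n}" and h: "half l = card (basis l) div 2" by (auto simp: valid_def)
  have "card (basis l) \<le> n" using card_mono[OF _ sub] by simp
  then have "half l < n" using h n by linarith
  moreover have "ratio l i j \<in> F n" for i j
    using v F F_zero[OF n] F_mult[OF n] F_inverse[OF n] by (auto simp: valid_def divide_inverse)
  ultimately show ?thesis using sub by (simp add: good_local_def)
qed

lemma relations_over_encode:
  assumes "2 \<le> n" "A \<subseteq> tuples n r" "\<And>p q t. good_local n (L p q t)"
  shows "relations_over n (aux_arities r) (encode n A L)"
  using encode_tuples[OF assms] by (simp add: relations_over_def)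

end

section \<open>Correctness of the answer along runs\<close>

locale matching_program = matching_fo r Res F cod W
  for r Res and F :: "nat \<Rightarrow> 'k::field_char2 set" and cod W +
  assumes isolating: "2 \<le> n \<Longrightarrow> E \<subseteq> all_pairs n \<Longrightarrow> \<exists>p<n. \<exists>q<n. \<exists>t<n. \<exists>U\<subseteq>{..<n}.
    card U = 2 * matching_number E \<and> pf (restrict_weight E (W n p q t)) U \<noteq> 0"
begin

text \<open>A nonzero Pfaffian gives a pairing of the basis by edges of nonzero weight, hence a
  matching of \<open>E\<close>; so no half exceeds the matching number. By \<open>isolating\<close>
  some assignment has a feasible set of twice that number, and its basis is at least as
  large.\<close>

lemma is_max_half_iff:
  assumes n: "2 \<le> n" and E: "E \<subseteq> all_pairs n"
    and opt: "\<And>p q t. optimal n (restrict_weight E (W n p q t)) (L p q t)"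
  shows "is_max_half n L m \<longleftrightarrow> m = matching_number E"
proof -
  have finE: "finite E" using E finite_all_pairs finite_subset by blast
  have le: "half (L p q t) \<le> matching_number E" for p q t
  proof -
    let ?S = "basis (L p q t)"
    have v: "valid n (restrict_weight E (W n p q t)) (L p q t)" using opt by (simp add: optimal_def)
    then have fin: "finite ?S" and nz: "pf (restrict_weight E (W n p q t)) ?S \<noteq> 0"
      by (auto simp: valid_def intro: finite_subset)
    obtain M where M: "M \<in> pairings ?S" "\<forall>e\<in>M. restrict_weight E (W n p q t) e \<noteq> 0"
      using pf_nonzeroD[OF fin nz] by metis
    then have "M \<subseteq> E" by (auto simp: restrict_weight_def split: if_splits)
    then have "matching E M" using M(1) by (simp add: matching_def pairings_def)
    then have "card M \<le> matching_number E" using finE by (intro matching_number_ge)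
    then show ?thesis using v card_pairing[OF fin M(1)] by (simp add: valid_def)
  qed
  obtain p q t U where pqt: "p < n" "q < n" "t < n" and U: "U \<subseteq> {..<n}"
    "card U = 2 * matching_number E" "pf (restrict_weight E (W n p q t)) U \<noteq> 0"
    using isolating[OF n E] by blast
  have "card U \<le> card (basis (L p q t))"
    using opt[of p q t] U(1,3) unfolding optimal_def by blast
  then have "matching_number E \<le> half (L p q t)"
    using U(2) opt[of p q t] by (simp add: optimal_def valid_def)
  then have "half (L p q t) = matching_number E" using le[of p q t] by simp
  then show ?thesis
    using pqt le unfolding is_max_half_def by (metis le_antisym not_less)
qed

text \<open>\<open>A\<^sub>1\<close> is the constant answer on the one-element domain. On larger
  domains the run starts from the empty graph, with matching number \<open>0\<close> and only the
  empty set feasible.\<close>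

definition initial_rels :: "nat list set \<Rightarrow> nat \<Rightarrow> relations" where
  "initial_rels A\<^sub>1 n =
    (if n = 1 then (\<lambda>j. if j = 0 then A\<^sub>1 else {})
     else encode n {bs. 0 # bs \<in> Res n} (\<lambda>_ _ _. initial_state))"

lemma run_program:
  assumes n: "2 \<le> n" and cs: "\<forall>c\<in>set cs. valid_change n graph_schema c"
  shows "\<exists>I L. run n program (initial_rels A\<^sub>1 n) cs
      = (I, encode n {bs. matching_number (edges I) # bs \<in> Res n} L) \<and> I 0 \<subseteq> tuples n 2 \<and>
    (\<forall>p q t. optimal n (restrict_weight (edges I) (W n p q t)) (L p q t))"
  using cs
proof (induction cs rule: rev_induct)
  case Nil
  have no_edges: "edges (\<lambda>_. {}) = {}" by (simp add: edges_def)
  have "restrict_weight {} x = (\<lambda>_. 0)" for x :: "nat set \<Rightarrow> 'k" by (simp add: restrict_weight_def)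
  then show ?case
    using n by (intro exI[of _ "\<lambda>_. {}"] exI[of _ "\<lambda>_ _ _. initial_state"])
      (simp add: run_def initial_rels_def no_edges matching_number_empty initial_optimal)
next
  case (snoc c cs)
  then obtain I L where run: "run n program (initial_rels A\<^sub>1 n) cs
      = (I, encode n {bs. matching_number (edges I) # bs \<in> Res n} L)" and I: "I 0 \<subseteq> tuples n 2" and
    opt: "\<And>p q t. optimal n (restrict_weight (edges I) (W n p q t)) (L p q t)"
    by auto
  obtain \<kappa> a b where c: "c = (\<kappa>, 0, [a, b])" and ab: "a < n" "b < n"
    using snoc.prems by (cases c) (auto simp: valid_change_def graph_schema_def tuples_def length_Suc_conv numeral_2_eq_2)
  define A where "A = {bs. matching_number (edges I) # bs \<in> Res n}"
  define s where "s = \<lparr>domain_size = n, input_rels = I, answer_rel = A, locals = L\<rparr>"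
  let ?I = "apply_change c I"
  have opt': "optimal n (restrict_weight (edges ?I) (W n p q t)) (next_local \<kappa> s a b p q t)" for p q t
  proof -
    \<comment> \<open>A loop never toggles, so its increment is \<open>0\<close>, as
      \<open>update_optimal\<close> demands.\<close>
    have "a \<noteq> b \<or> (if toggles \<kappa> I a b then W n p q t {a, b} else 0) = 0"
      by (simp add: toggles_def)
    from update_optimal[OF opt ab this] show ?thesis
      unfolding c restrict_weight_change next_local_def s_def dyn_state.simps .
  qed
  have I': "?I 0 \<subseteq> tuples n 2" using I snoc.prems by (intro apply_change_tuples) simp_all
  have A: "A \<subseteq> tuples n r" using Res_tail by (simp add: A_def)
  have step: "step n program c (I, encode n A L) = (?I, encode n (next_answer \<kappa> s a b) (next_local \<kappa> s a b))"
    unfolding c using step_program[OF n optimal_good[OF n opt] ab s_def A optimal_good[OF n opt']] .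
  have E': "edges ?I \<subseteq> all_pairs n" by (intro edges_subset I')
  \<comment> \<open>The formula for the answer quantifies over the domain, so the matching number
    has to be a domain element.\<close>
  have "matching_number (edges ?I) < n"
    using matching_number_le[OF E'] n by linarith
  then have "next_answer \<kappa> s a b = {bs. matching_number (edges ?I) # bs \<in> Res n}"
    using is_max_half_iff[OF n E' opt'] by (auto simp: next_answer_def s_def)
  then have "run n program (initial_rels A\<^sub>1 n) (cs @ [c])
      = (?I, encode n {bs. matching_number (edges ?I) # bs \<in> Res n} (next_local \<kappa> s a b))"
    using run step by (simp add: run_def A_def)
  then show ?case using I' opt' by blast
qed

lemma run_program_1:
  assumes A: "A\<^sub>1 \<subseteq> tuples 1 r" and cs: "\<forall>c\<in>set cs. valid_change 1 graph_schema c"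
  shows "\<exists>I A. run 1 program (initial_rels A\<^sub>1 1) cs = (I, A) \<and> A 0 = A\<^sub>1 \<and> I 0 \<subseteq> tuples 1 2"
  using cs
proof (induction cs rule: rev_induct)
  case Nil
  then show ?case by (simp add: run_def initial_rels_def)
next
  case (snoc c cs)
  then obtain I A where run: "run 1 program (initial_rels A\<^sub>1 1) cs = (I, A)" "A 0 = A\<^sub>1" and I: "I 0 \<subseteq> tuples 1 2"
    by auto
  obtain \<kappa> a b where c: "c = (\<kappa>, 0, [a, b])"
    using snoc.prems by (cases c) (auto simp: valid_change_def graph_schema_def tuples_def length_Suc_conv numeral_2_eq_2)
  have "{bs \<in> tuples 1 r. sat 1 (interp I A) ((!) (a # b # bs)) (keep 0)} = A\<^sub>1"
    using A run(2) sat_keep[of _ 0] by (auto simp: tuples_def aux_arities_def)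
  then have "snd (step 1 program c (I, A)) 0 = A\<^sub>1"
    by (simp add: c program_def sat_lone) (simp add: aux_arities_def)
  moreover have "apply_change c I 0 \<subseteq> tuples 1 2"
    using I snoc.prems by (intro apply_change_tuples) simp_all
  ultimately show ?case using run by (simp add: run_def c)
qed

theorem query_in_DynFO:
  assumes ar: "query_arity q = r"
    and q: "\<And>n I. 2 \<le> n \<Longrightarrow> I 0 \<subseteq> tuples n 2 \<Longrightarrow>
      answer q n I = {bs. matching_number (edges I) # bs \<in> Res n}"
    and q1: "\<And>I. I 0 \<subseteq> tuples 1 2 \<Longrightarrow> answer q 1 I = A\<^sub>1" and A: "A\<^sub>1 \<subseteq> tuples 1 r"
  shows "q \<in> nonuniform_DynFO graph_schema"
proof -
  have "relations_over n (aux_arities r) (initial_rels A\<^sub>1 n)" if "1 \<le> n" for n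
  proof (cases "n = 1")
    case True
    then show ?thesis using A by (auto simp: relations_over_def initial_rels_def aux_arities_def)
  next
    case False
    then have n: "2 \<le> n" using that by simp
    have "restrict_weight {} (W n p q t) = (\<lambda>_. 0)" for p q t by (simp add: restrict_weight_def)
    then have "good_local n initial_state"
      using optimal_good[OF n, of "{}" 0 0 0 initial_state] initial_optimal[where ?'k = 'k] by simp
    then show ?thesis using Res_tail[of 0 n] relations_over_encode[OF n] False by (simp add: initial_rels_def)
  qed
  moreover have "case run n program (initial_rels A\<^sub>1 n) cs of (I, A) \<Rightarrow> A 0 = answer q n I"
    if n: "1 \<le> n" and cs: "\<forall>c\<in>set cs. valid_change n graph_schema c" for n cs
  proof (cases "n = 1")
    case True
    then obtain I B where "run n program (initial_rels A\<^sub>1 n) cs = (I, B)" "B 0 = A\<^sub>1" "I 0 \<subseteq> tuples 1 2"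
      using run_program_1[OF A, of cs] cs by blast
    then show ?thesis using q1 True by simp
  next
    case False
    then have "2 \<le> n" using n by simp
    then show ?thesis using run_program[OF _ cs, of A\<^sub>1] q by (auto simp: encode_def)
  qed
  ultimately have "maintains graph_schema program (initial_rels A\<^sub>1) q"
    by (auto simp: maintains_def program_def aux_arities_def ar)
  then show ?thesis
    using wf_program \<open>\<And>n. 1 \<le> n \<Longrightarrow> relations_over n (aux_arities r) (initial_rels A\<^sub>1 n)\<close>
    unfolding nonuniform_DynFO_def by (intro CollectI exI conjI) (auto simp: program_def)
qed

end

text \<open>The fields, codes and weights are chosen before \<open>r\<close> and \<open>Res\<close>,
  so that the same data serve both queries.\<close>

lemma matching_parameters:
  "\<exists>(F :: nat \<Rightarrow> bit alg_closure set) cod W. \<forall>r Res.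
    (\<forall>n. Res n \<subseteq> tuples n (Suc r)) \<longrightarrow> matching_program r Res F cod W"
proof -
  have "\<exists>F c V. 2 \<le> n \<longrightarrow> (\<exists>k. F = (GF k :: bit alg_closure set)) \<and> inj_on c F \<and> (\<forall>x\<in>F. c x < n) \<and>
      (\<forall>p q t e. V p q t e \<in> F) \<and>
      (\<forall>E. E \<subseteq> all_pairs n \<longrightarrow> (\<exists>p<n. \<exists>q<n. \<exists>t<n. \<exists>U\<subseteq>{..<n}.
        card U = 2 * matching_number E \<and> pf (restrict_weight E (V p q t)) U \<noteq> 0))" for n :: nat
  proof (cases "2 \<le> n")
    case True
    \<comment> \<open>The largest power of two not above \<open>n\<close>, so that
      \<open>card F \<le> n < 2 * card F\<close> as \<open>isolating_weights\<close> asks.\<close>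
    obtain k where k: "2 ^ k \<le> n" "n < 2 ^ (k + 1)"
      using ex_power_ivl1[of 2 n] True by auto
    have "0 < k" using k True by (cases k) auto
    define F where "F = (GF k :: bit alg_closure set)"
    have F: "finite F" "card F = 2 ^ k" using card_GF[OF \<open>0 < k\<close>] by (simp_all add: F_def)
    obtain V :: "nat \<Rightarrow> nat \<Rightarrow> nat \<Rightarrow> nat set \<Rightarrow> bit alg_closure" where
      V: "\<And>p q t e. V p q t e \<in> F" "\<And>E. E \<subseteq> all_pairs n \<Longrightarrow> \<exists>p<n. \<exists>q<n. \<exists>t<n. \<exists>U\<subseteq>{..<n}.
        card U = 2 * matching_number E \<and> pf (restrict_weight E (V p q t)) U \<noteq> 0"
      by (rule isolating_weights[OF True F(1)]) (use F k GF_closed(1) in \<open>auto simp: F_def\<close>)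
    obtain c where "bij_betw c F {0..<card F}" using ex_bij_betw_finite_nat[OF F(1)] by auto
    then have "inj_on c F" "\<forall>x\<in>F. c x \<in> {0..<card F}"
      by (auto simp only: bij_betw_def)
    then have "inj_on c F" "\<forall>x\<in>F. c x < n"
      using F k by auto
    then show ?thesis using V unfolding F_def by blast
  qed simp
  then obtain F :: "nat \<Rightarrow> bit alg_closure set" and c V where
    *: "\<And>n. 2 \<le> n \<Longrightarrow> (\<exists>k. F n = GF k) \<and> inj_on (c n) (F n) \<and> (\<forall>x\<in>F n. c n x < n) \<and>
      (\<forall>p q t e. V n p q t e \<in> F n) \<and>
      (\<forall>E. E \<subseteq> all_pairs n \<longrightarrow> (\<exists>p<n. \<exists>q<n. \<exists>t<n. \<exists>U\<subseteq>{..<n}.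
        card U = 2 * matching_number E \<and> pf (restrict_weight E (V n p q t)) U \<noteq> 0))"
    by metis
  have GF: "\<exists>k. F n = GF k" if "2 \<le> n" for n
    using *[OF that] by (elim conjE)
  show ?thesis
  proof (intro exI allI impI)
    fix r and Res :: "nat \<Rightarrow> nat list set" assume res: "\<forall>n. Res n \<subseteq> tuples n (Suc r)"
    show "matching_program r Res F c V"
    proof (unfold_locales, goal_cases)
      case (1 n) show ?case using GF[OF 1(1)] GF_closed(1) by metis
    next
      case (2 n) show ?case using GF[OF 2(1)] GF_closed(2) by metis
    next
      case (3 n) show ?case using GF[OF 3(1)] GF_closed(3) 3(2,3) by metis
    next
      case (4 n) show ?case using GF[OF 4(1)] GF_closed(4) 4(2,3) by metis
    next
      case (5 n) show ?case using GF[OF 5(1)] GF_closed(5) 5(2) by metis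
    next
      case 6 show ?case using *[OF 6(1)] by (elim conjE)
    next
      case 7 show ?case using *[OF 7(1)] 7(2) by (elim conjE) (rule bspec)
    next
      case 8 show ?case using *[OF 8(1)] by (elim conjE) (elim allE)
    next
      case 9 show ?case using res by simp
    next
      case 10 show ?case using *[OF 10(1)] 10(2) by (elim conjE) (elim allE impE)
    qed
  qed
qed

lemma perfect_matching_iff:
  assumes E: "E \<subseteq> all_pairs n"
  shows "(\<exists>M. perfect_matching {..<n} E M) \<longleftrightarrow> 2 * matching_number E = n"
proof
  assume "\<exists>M. perfect_matching {..<n} E M"
  then obtain M where M: "matching E M" "\<Union>M = {..<n}" by (auto simp: perfect_matching_def)
  have "finite E" using E finite_all_pairs finite_subset by blast
  then have "card M \<le> matching_number E" using M(1) by (rule matching_number_ge)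
  moreover have "2 * card M = n" using matching_card_le(2)[OF E M(1)] M(2) by simp
  ultimately show "2 * matching_number E = n" using matching_number_le[OF E] by linarith
next
  assume eq: "2 * matching_number E = n"
  have "finite E" using E finite_all_pairs finite_subset by blast
  then obtain M where M: "matching E M" "card M = matching_number E" by (rule maximum_matching)
  have "\<Union>M = {..<n}"
    using matching_card_le(1,2)[OF E M(1)] M(2) eq by (intro card_subset_eq) auto
  then show "\<exists>M. perfect_matching {..<n} E M" using M(1) by (auto simp: perfect_matching_def)
qed

theorem theorem3:
  "PerfectMatching \<in> nonuniform_DynFO graph_schema \<and> MaxMatching \<in> nonuniform_DynFO graph_schema"
proof
  obtain F :: "nat \<Rightarrow> bit alg_closure set" and cod W where
    params: "\<And>r Res. \<forall>n. Res n \<subseteq> tuples n (Suc r) \<Longrightarrow> matching_program r Res F cod W"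
    using matching_parameters by metis
  have number_1: "matching_number (edges I) = 0" if "I 0 \<subseteq> tuples 1 2" for I
    using matching_number_le[OF edges_subset[of I 1, OF that]] by simp
  \<comment> \<open>The table accepts the empty tuple exactly at matching number
    \<open>n / 2\<close>.\<close>
  interpret P: matching_program 0 "\<lambda>n. {[m] | m. m < n \<and> 2 * m = n}" F cod W
    by (rule params) (auto simp: tuples_def)
  show "PerfectMatching \<in> nonuniform_DynFO graph_schema"
  proof (rule P.query_in_DynFO)
    fix n and I :: relations assume "2 \<le> n" "I 0 \<subseteq> tuples n 2"
    then show "answer PerfectMatching n I
        = {bs. matching_number (edges I) # bs \<in> {[m] | m. m < n \<and> 2 * m = n}}"
      using perfect_matching_iff[OF edges_subset, of I n] by (auto simp: PerfectMatching_def)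
  next
    fix I :: relations assume "I 0 \<subseteq> tuples 1 2"
    then show "answer PerfectMatching 1 I = {}"
      using perfect_matching_iff[OF edges_subset, of I 1] number_1 by (simp add: PerfectMatching_def)
  qed (simp_all add: PerfectMatching_def)
  \<comment> \<open>The table is the diagonal: the answer is the matching number itself.\<close>
  interpret M: matching_program 1 "\<lambda>n. {[m, m] | m. m < n}" F cod W
    by (rule params) (auto simp: tuples_def)
  have answer: "answer MaxMatching n I = {[matching_number (edges I)]}" for n I
    by (simp add: MaxMatching_def matching_number_def)
  show "MaxMatching \<in> nonuniform_DynFO graph_schema"
  proof (rule M.query_in_DynFO)
    fix n and I :: relations assume n: "2 \<le> n" "I 0 \<subseteq> tuples n 2"
    then have "matching_number (edges I) < n"
      using matching_number_le[OF edges_subset[of I n, OF n(2)]] by linarith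
    then show "answer MaxMatching n I = {bs. matching_number (edges I) # bs \<in> {[m, m] | m. m < n}}"
      by (auto simp: answer)
  next
    fix I :: relations assume "I 0 \<subseteq> tuples 1 2"
    then show "answer MaxMatching 1 I = {[0]}" by (simp add: answer number_1)
  qed (auto simp: MaxMatching_def tuples_def)
qed

end
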